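(* Consider the structured linear-concave-affine isoperimetric control problem described in the context, with value function $V(B)=\sup\{J(u):u\in\mathcal U,\ \mathcal C(u)=B\}$ ($=-\infty$ if infeasible), $\operatorname{dom}V=\mathcal C(\mathcal U)$, dual-optimal multiplier sets $\mathcal D(B)$ and Pontryagin multiplier sets $\mathcal M(B)$ as defined in the context. Then for every $B\in\operatorname{int}(\operatorname{dom}V)$ (equivalently, every $B$ for which there exist admissible controls with constraint levels strictly below and strictly above $B$), $$\partial^+V(B)=-\mathcal M(B)=-\mathcal D(B).$$ In particular, at every differentiability point $B$ of $V$, the isoperimetric Pontryagin multiplier $\mu$ is unique and $V'(B)=-\mu$.
   Context: Structured class. Fix $T>0$, $x_0\in\mathbb R^n$, and a nonempty, compact, convex set $U\subset\mathbb R^m$. Let $\mathcal U=\{u\in L^\infty(0,T;\mathbb R^m): u(t)\in U\text{ for a.e. }t\}$. For $u\in\mathcal U$ let $x_u\in W^{1,\infty}(0,T;\mathbb R^n)$ be the unique solution of $\dot x(t)=A(t)x(t)+B(t)u(t)$, $x(0)=x_0$, where $A,B$ are measurable and bounded matrix functions of sizes $n\times n$ and $n\times m$ (the matrix function $B(\cdot)$ is unrelated to the scalar level $B$). The payoff is $J(u)=\int_0^T f(t,x_u(t),u(t))\,dt+\phi(x_u(T))$, where: $f:[0,T]\times\mathbb R^n\times\mathbb R^m\to\mathbb R$ is measurable in $t$ for each $(x,u)$; $f(t,\cdot,\cdot)$ is $C^1$ for a.e. $t$ and concave (and upper semicontinuous); $|f(t,x,u)|\le c(1+\|x\|^2+\|u\|^2)$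 on $[0,T]\times\mathbb R^n\times U$; $\phi\in C^1(\mathbb R^n)$ is concave (and upper semicontinuous) with $|\phi(x)|\le c(1+\|x\|^2)$, for some $c>0$. Moreover $J$ is assumed weak-$*$ upper semicontinuous on $\mathcal U$ (weak-$*$ topology of $L^\infty=(L^1)^*$). The constraint functional is $\mathcal C(u)=\int_0^T h(t,x_u(t),u(t))\,dt$ with $h(t,x,u)=a(t)^\top x+b(t)^\top u+c_0(t)$, where $a,b,c_0$ are measurable and bounded. Superdifferential: $\partial^+V(B)=\{p\in\mathbb R: V(\widetilde B)-V(B)\le p(\widetilde B-B)\ \forall\,\widetilde B\in\operatorname{dom}V\}$. Dual multipliers: $\ell(\mu)=\sup_{u\in\mathcal U}\{J(u)+\mu\,\mathcal C(u)\}$ and $\mathcal D(B)=\operatorname{arg\,min}_{\mu\in\mathbb R}\{\ell(\mu)-\mu B\}$. Pontryagin multipliers: $\mathcal M(B)$ is the set of constants $\mu\in\mathbb R$ for which there exist an optimal control $u^*$ at level $B$ (i.e. $u^*\in\mathcal U$, $\mathcal C(u^* )=B$, $J(u^* )=V(B)$), with $x^*=x_{u^*}$, and $\lambda\in W^{1,1}(0,T;\mathbb R^n)$ such that, with $\widetilde H(t,x,u,\lambda,\mu)=f(t,x,u)+\lambda^\top(A(t)x+B(t)u)+\mu\,h(t,x,u)$, for a.e. $t$: $\dot\lambda(t)=-\nabla_x\widetilde H(t,x^*(t),u^*(t),\lambda(t),\mu)$ and $\widetilde H(t,x^*(t),u^*(t),\lambda(t),\mu)=\max_{v\in U}\widetilde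 H(t,x^*(t),v,\lambda(t),\mu)$, together with $\lambda(T)=\nabla\phi(x^*(T))$. *)

theory Defs
  imports "HOL-Analysis.Analysis"
begin

section \<open>Function spaces on \<open>[0,T]\<close>\<close>

abbreviation interval_measure :: "real \<Rightarrow> real measure" where
  "interval_measure T \<equiv> lebesgue_on {0..T}"

text \<open>Elements of the Lebesgue spaces are represented by functions, not by classes modulo
  null sets; trajectories, payoff and constraint do not depend on the representative of a control.\<close>

definition L1 :: "real \<Rightarrow> (real \<Rightarrow> 'a::euclidean_space) set" where
  "L1 T = {p. integrable (interval_measure T) p}"

definition Linf :: "real \<Rightarrow> (real \<Rightarrow> 'a::euclidean_space) set" where
  "Linf T = {u. u \<in> borel_measurable (interval_measure T) \<and>
                (\<exists>K. AE t in interval_measure T. norm (u t) \<le> K)}"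

text \<open>\<open>weak_derivative T x v\<close>: \<open>x\<close> is the continuous representative of an element of
  \<open>W\<^sup>1\<^sup>,\<^sup>1(0,T)\<close> whose derivative is (the class of) \<open>v\<close>. On an interval this space consists of the
  primitives of integrable functions; \<open>W\<^sup>1\<^sup>,\<^sup>\<infinity>(0,T)\<close> is the case \<open>v \<in> Linf T\<close>.\<close>

definition weak_derivative ::
    "real \<Rightarrow> (real \<Rightarrow> 'a::euclidean_space) \<Rightarrow> (real \<Rightarrow> 'a) \<Rightarrow> bool" where
  "weak_derivative T x v \<longleftrightarrow>
     v \<in> L1 T \<and> (\<forall>t\<in>{0..T}. x t = x 0 + (LINT s|lebesgue_on {0..t}. v s))"

text \<open>The weak-* topology of \<open>Linf T\<close> as the dual of \<open>L1 T\<close>: the initial topology of the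
  pairings \<open>u \<mapsto> \<integral> p \<bullet> u\<close>, \<open>p \<in> L1 T\<close>.\<close>

definition weak_star :: "real \<Rightarrow> (real \<Rightarrow> 'a::euclidean_space) topology" where
  "weak_star T = pullback_topology (Linf T)
     (\<lambda>u. \<lambda>p\<in>L1 T. LINT t|interval_measure T. p t \<bullet> u t) (powertop_real (L1 T))"

definition usc_map :: "'a topology \<Rightarrow> ('a \<Rightarrow> real) \<Rightarrow> bool" where
  "usc_map X g \<longleftrightarrow> (\<forall>\<alpha>. openin X {x \<in> topspace X. g x < \<alpha>})"

definition C1 :: "('a::real_inner \<Rightarrow> real) \<Rightarrow> bool" where
  "C1 g \<longleftrightarrow> (\<exists>G. (\<forall>z. GDERIV g z :> G z) \<and> continuous_on UNIV G)"

definition gradient :: "('a::real_inner \<Rightarrow> real) \<Rightarrow> 'a \<Rightarrow> 'a" where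
  "gradient g z = (THE D. GDERIV g z :> D)"

section \<open>The control problem\<close>

text \<open>Data: \<open>T\<close>, \<open>x\<^sub>0\<close>, \<open>U\<close>, \<open>A\<close>, \<open>B\<close>, \<open>f\<close>, \<open>\<phi>\<close>, and \<open>a\<close>, \<open>b\<close>, \<open>c\<^sub>0\<close>, in this order.\<close>

record ('n::finite, 'm::finite) control_problem =
  horizon :: real
  init_state :: "real^'n"
  control_set :: "(real^'m) set"
  state_mat :: "real \<Rightarrow> real^'n^'n"
  control_mat :: "real \<Rightarrow> real^'m^'n"
  run_payoff :: "real \<Rightarrow> real^'n \<Rightarrow> real^'m \<Rightarrow> real"
  term_payoff :: "real^'n \<Rightarrow> real"
  con_state :: "real \<Rightarrow> real^'n"
  con_control :: "real \<Rightarrow> real^'m"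
  con_const :: "real \<Rightarrow> real"

abbreviation time_measure :: "('n::finite,'m::finite) control_problem \<Rightarrow> real measure" where
  "time_measure P \<equiv> interval_measure (horizon P)"

definition admissible :: "('n::finite,'m::finite) control_problem \<Rightarrow> (real \<Rightarrow> real^'m) set" where
  "admissible P = {u \<in> Linf (horizon P). AE t in time_measure P. u t \<in> control_set P}"

definition velocity ::
    "('n::finite,'m::finite) control_problem \<Rightarrow> real \<Rightarrow> real^'n \<Rightarrow> real^'m \<Rightarrow> real^'n" where
  "velocity P t x u = state_mat P t *v x + control_mat P t *v u"

definition is_trajectory ::
    "('n::finite,'m::finite) control_problem \<Rightarrow> (real \<Rightarrow> real^'m) \<Rightarrow> (real \<Rightarrow> real^'n) \<Rightarrow> bool" where
  "is_trajectory P u x \<longleftrightarrow> x 0 = init_state P \<and>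
     (\<exists>v. v \<in> Linf (horizon P) \<and> weak_derivative (horizon P) x v \<and>
          (AE t in time_measure P. v t = velocity P t (x t) (u t)))"

text \<open>The trajectory is unique on \<open>[0,T]\<close>; the values chosen outside this interval are
  never used.\<close>

definition trajectory ::
    "('n::finite,'m::finite) control_problem \<Rightarrow> (real \<Rightarrow> real^'m) \<Rightarrow> real \<Rightarrow> real^'n" where
  "trajectory P u = (SOME x. is_trajectory P u x)"

definition payoff ::
    "('n::finite,'m::finite) control_problem \<Rightarrow> (real \<Rightarrow> real^'m) \<Rightarrow> real" where
  "payoff P u = (LINT t|time_measure P. run_payoff P t (trajectory P u t) (u t)) +
     term_payoff P (trajectory P u (horizon P))"

definition con_density ::
    "('n::finite,'m::finite) control_problem \<Rightarrow> real \<Rightarrow> real^'n \<Rightarrow> real^'m \<Rightarrow> real" where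
  "con_density P t x u = con_state P t \<bullet> x + con_control P t \<bullet> u + con_const P t"

definition constraint ::
    "('n::finite,'m::finite) control_problem \<Rightarrow> (real \<Rightarrow> real^'m) \<Rightarrow> real" where
  "constraint P u = (LINT t|time_measure P. con_density P t (trajectory P u t) (u t))"

definition bounded_measurable :: "real \<Rightarrow> (real \<Rightarrow> 'a::euclidean_space) \<Rightarrow> bool" where
  "bounded_measurable T g \<longleftrightarrow>
     g \<in> borel_measurable (interval_measure T) \<and> bounded (g ` {0..T})"

definition structured_problem :: "('n::finite,'m::finite) control_problem \<Rightarrow> bool" where
  "structured_problem P \<longleftrightarrow>
     horizon P > 0 \<and>
     control_set P \<noteq> {} \<and> compact (control_set P) \<and> convex (control_set P) \<and>
     bounded_measurable (horizon P) (state_mat P) \<and>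
     bounded_measurable (horizon P) (control_mat P) \<and>
     (\<forall>x u. (\<lambda>t. run_payoff P t x u) \<in> borel_measurable (time_measure P)) \<and>
     (AE t in time_measure P.
        C1 (case_prod (run_payoff P t)) \<and>
        concave_on UNIV (case_prod (run_payoff P t)) \<and>
        usc_map euclidean (case_prod (run_payoff P t))) \<and>
     C1 (term_payoff P) \<and> concave_on UNIV (term_payoff P) \<and>
     usc_map euclidean (term_payoff P) \<and>
     (\<exists>c>0. (\<forall>t\<in>{0..horizon P}. \<forall>x. \<forall>u\<in>control_set P.
               \<bar>run_payoff P t x u\<bar> \<le> c * (1 + (norm x)\<^sup>2 + (norm u)\<^sup>2)) \<and>
            (\<forall>x. \<bar>term_payoff P x\<bar> \<le> c * (1 + (norm x)\<^sup>2))) \<and>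
     usc_map (subtopology (weak_star (horizon P)) (admissible P)) (payoff P) \<and>
     bounded_measurable (horizon P) (con_state P) \<and>
     bounded_measurable (horizon P) (con_control P) \<and>
     bounded_measurable (horizon P) (con_const P)"

section \<open>Value function and multipliers\<close>

text \<open>The supremum over the empty set is \<open>-\<infinity>\<close> in \<^typ>\<open>ereal\<close>.\<close>

definition value_fun :: "('n::finite,'m::finite) control_problem \<Rightarrow> real \<Rightarrow> ereal" where
  "value_fun P B = (SUP u\<in>{u \<in> admissible P. constraint P u = B}. ereal (payoff P u))"

definition value_dom :: "('n::finite,'m::finite) control_problem \<Rightarrow> real set" where
  "value_dom P = constraint P ` admissible P"

definition superdifferential ::
    "('n::finite,'m::finite) control_problem \<Rightarrow> real \<Rightarrow> real set" where
  "superdifferential P B =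
     {p. \<forall>B'\<in>value_dom P. value_fun P B' - value_fun P B \<le> ereal (p * (B' - B))}"

definition dual_fun :: "('n::finite,'m::finite) control_problem \<Rightarrow> real \<Rightarrow> ereal" where
  "dual_fun P \<mu> = (SUP u\<in>admissible P. ereal (payoff P u + \<mu> * constraint P u))"

definition dual_multipliers ::
    "('n::finite,'m::finite) control_problem \<Rightarrow> real \<Rightarrow> real set" where
  "dual_multipliers P B =
     {\<mu>. is_arg_min (\<lambda>\<mu>. dual_fun P \<mu> - ereal (\<mu> * B)) (\<lambda>_. True) \<mu>}"

definition optimal_control ::
    "('n::finite,'m::finite) control_problem \<Rightarrow> real \<Rightarrow> (real \<Rightarrow> real^'m) \<Rightarrow> bool" where
  "optimal_control P B u \<longleftrightarrow>
     u \<in> admissible P \<and> constraint P u = B \<and> ereal (payoff P u) = value_fun P B"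

definition hamiltonian ::
    "('n::finite,'m::finite) control_problem \<Rightarrow>
      real \<Rightarrow> real^'n \<Rightarrow> real^'m \<Rightarrow> real^'n \<Rightarrow> real \<Rightarrow> real" where
  "hamiltonian P t x u l \<mu> =
     run_payoff P t x u + l \<bullet> velocity P t x u + \<mu> * con_density P t x u"

definition pontryagin_multipliers ::
    "('n::finite,'m::finite) control_problem \<Rightarrow> real \<Rightarrow> real set" where
  "pontryagin_multipliers P B =
     {\<mu>. \<exists>u l l'. optimal_control P B u \<and> weak_derivative (horizon P) l l' \<and>
        (AE t in time_measure P.
           l' t = - gradient (\<lambda>x. hamiltonian P t x (u t) (l t) \<mu>) (trajectory P u t) \<and>
           is_arg_max (\<lambda>v. hamiltonian P t (trajectory P u t) v (l t) \<mu>)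
             (\<lambda>v. v \<in> control_set P) (u t)) \<and>
        l (horizon P) = gradient (term_payoff P) (trajectory P u (horizon P))}"

end

theory Submission
  imports Defs
begin

text \<open>
  The dynamics and the constraint are affine in the control and the payoff is concave, so the pairs
  \<open>(\<C>(u), J(u))\<close> form, up to lowering \<open>J\<close>, a convex set in the plane with upper boundary \<open>V\<close>.
  At an interior level \<open>V\<close> has supporting lines, and \<open>-\<mu>\<close> is the slope of one of them iff the optimal
  controls at that level maximise \<open>J + \<mu> \<C>\<close> over all admissible controls, iff \<open>\<mu>\<close> minimises the dual
  function. Pontryagin's conditions with multiplier \<open>\<mu>\<close> are in turn equivalent to this unconstrained
  maximality: sufficiency is Mangasarian's argument (gradient inequality for the concave Hamiltonian
  and integration by parts against the adjoint state); for necessity the one-sided derivative along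
  \<open>w + \<theta> (v - w)\<close> is nonpositive, and the resulting integral inequality is localised by switching
  from \<open>w\<close> to a constant control on a measurable set of times.

  Optimal controls are strong limits: in the nested convex sets \<open>{J \<ge> V(B) - 1/n, \<C> = B}\<close>, elements of
  almost minimal \<open>L\<^sup>2\<close> norm form a Cauchy sequence.
\<close>

section \<open>Primitives of integrable functions\<close>

text \<open>The three multiplier sets are not compared with one another directly: each is reduced to
  the relation \<open>maximizes \<mu> w\<close> for an optimal control w at level B. Membership in
  the superdifferential does not mention w, so all optimal controls at one level have the same
  multipliers, and the existential quantifier over controls in \<open>pontryagin_multipliers\<close>
  is harmless once one optimal control is known to exist. Interiority of B keeps the supporting line
  from being vertical; this is what makes the dual minimum equal to V(B). The obstacle to necessity
  is that no bound is available for the control component of the gradient of f, because the growth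
  condition concerns only controls in U. The adjoint equation, however, contains only the state
  component, which is bounded. The adjoint state can therefore be built from w and \<mu> before any
  competitor is considered, and the same one serves all competitors.\<close>

lemma primitive_eq_integral:
  fixes v :: "real \<Rightarrow> 'a::euclidean_space"
  assumes "integrable (lebesgue_on {0..T}) v" "t \<in> {0..T}"
  shows "(LINT s|lebesgue_on {0..t}. v s) = integral {0..t} v"
    and "integral {0..t} v = (LINT s|lebesgue_on {0..T}. indicator {0..t} s *\<^sub>R v s)"
proof -
  have sub: "{0..t} \<subseteq> {0..T}" using assms by auto
  have "set_integrable lebesgue {0..T} v"
    using assms(1) by (simp add: integrable_restrict_space set_integrable_def)
  then have "set_integrable lebesgue {0..t} v"
    by (rule set_integrable_subset) (use sub in auto)
  then have i: "integrable (lebesgue_on {0..t}) v"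
    by (simp add: integrable_restrict_space set_integrable_def)
  show "(LINT s|lebesgue_on {0..t}. v s) = integral {0..t} v"
    by (rule lebesgue_integral_eq_integral) (use i in auto)
  \<comment> \<open>Moving t from the measure into an indicator keeps the measure fixed, the form
    that Fubini and almost-everywhere replacement of v require.\<close>
  have "(LINT s|lebesgue_on {0..T}. indicator {0..t} s *\<^sub>R v s) = (LINT s|lebesgue_on {0..t}. v s)"
    using sub by (simp add: integral_restrict_space flip: scaleR_scaleR indicator_inter_arith)
       (rule Bochner_Integration.integral_cong, auto split: split_indicator)
  with \<open>_ = integral {0..t} v\<close>
  show "integral {0..t} v = (LINT s|lebesgue_on {0..T}. indicator {0..t} s *\<^sub>R v s)" by simp
qed

lemma weak_derivative_eq:
  assumes "weak_derivative T x v" "t \<in> {0..T}"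
  shows "x t = x 0 + integral {0..t} v"
proof -
  have "integrable (lebesgue_on {0..T}) v" using assms(1) by (simp add: weak_derivative_def L1_def)
  moreover have "x t = x 0 + (LINT s|lebesgue_on {0..t}. v s)"
    using assms unfolding weak_derivative_def by blast
  ultimately show ?thesis using primitive_eq_integral(1)[OF _ assms(2)] by metis
qed

lemma continuous_on_weak_derivative:
  assumes "weak_derivative T x v"
  shows "continuous_on {0..T} x"
proof -
  have v: "integrable (lebesgue_on {0..T}) v" using assms by (auto simp: weak_derivative_def L1_def)
  have "continuous_on {0..T} (\<lambda>t. x 0 + (LINT s|lebesgue_on {0..t}. v s))"
    by (intro continuous_intros indefinite_integral_continuous_real v)
  moreover have "x t = x 0 + (LINT s|lebesgue_on {0..t}. v s)" if "t \<in> {0..T}" for t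
    using assms that unfolding weak_derivative_def by blast
  ultimately show ?thesis by (metis (no_types, lifting) continuous_on_cong)
qed

text \<open>Fubini on the square, split along the diagonal.\<close>
lemma integral_by_parts_weak_derivative:
  fixes x y :: "real \<Rightarrow> 'a::euclidean_space"
  assumes x: "weak_derivative T x x'" and y: "weak_derivative T y y'" and T: "0 \<le> T"
  shows "integrable (lebesgue_on {0..T}) (\<lambda>t. x' t \<bullet> y t)"
    and "integrable (lebesgue_on {0..T}) (\<lambda>t. x t \<bullet> y' t)"
    and "x T \<bullet> y T - x 0 \<bullet> y 0 =
      (LINT t|lebesgue_on {0..T}. x' t \<bullet> y t) + (LINT t|lebesgue_on {0..T}. x t \<bullet> y' t)"
proof -
  define M where "M = lebesgue_on {0..T}"
  interpret finite_measure M
    unfolding M_def by (rule finite_measure_lebesgue_on) auto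
  interpret pair_sigma_finite M M ..
  have ix: "integrable M x'" and iy: "integrable M y'"
    using x y by (auto simp: weak_derivative_def L1_def M_def)
  have [measurable]: "x' \<in> borel_measurable M" "y' \<in> borel_measurable M"
    using ix iy by auto
  \<comment> \<open>The measurable sets of M are the Lebesgue sets, so the identity is measurable
    only because they include the Borel sets. This makes the two triangles measurable in the
    product.\<close>
  have id[measurable]: "(\<lambda>s. s) \<in> borel_measurable M"
    unfolding M_def by (rule measurable_restrict_space1) (simp add: measurable_completion)
  have sp: "space M = {0..T}" by (simp add: M_def)
  define F where "F s t = x' s \<bullet> y' t" for s t
  have F0: "integrable (M \<Otimes>\<^sub>M M) (\<lambda>(s,t). F s t)"
  proof (rule Fubini_integrable)
    show "(\<lambda>(s,t). F s t) \<in> borel_measurable (M \<Otimes>\<^sub>M M)" unfolding F_def by measurable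
    show "AE s in M. integrable M (\<lambda>t. case (s,t) of (s,t) \<Rightarrow> F s t)"
      using iy by (auto simp: F_def)
    have "integrable M (\<lambda>s. LINT t|M. norm (F s t))"
    proof (rule Bochner_Integration.integrable_bound)
      show "integrable M (\<lambda>s. norm (x' s) * (LINT t|M. norm (y' t)))"
        using ix by auto
      show "(\<lambda>s. LINT t|M. norm (F s t)) \<in> borel_measurable M"
        unfolding F_def by measurable
      have "(LINT t|M. norm (F s t)) \<le> norm (x' s) * (LINT t|M. norm (y' t))" for s
      proof -
        have "(LINT t|M. norm (F s t)) \<le> (LINT t|M. norm (x' s) * norm (y' t))"
          by (rule integral_mono) (use iy in \<open>auto simp: F_def Cauchy_Schwarz_ineq2\<close>)
        then show ?thesis by simp
      qed
      moreover have "0 \<le> (LINT t|M. norm (F s t))" for s by simp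
      ultimately show "AE s in M. norm (LINT t|M. norm (F s t)) \<le> norm (norm (x' s) * (LINT t|M. norm (y' t)))"
        by (intro AE_I2) (smt (verit) real_norm_def)
    qed
    then show "integrable M (\<lambda>s. LINT t|M. norm (case (s,t) of (s,t) \<Rightarrow> F s t))" by simp
  qed
  \<comment> \<open>The triangle s \<le> t will be integrated in s first, which rebuilds x t - x 0;
    the triangle t < s in t first, which rebuilds y s - y 0. The diagonal belongs to
    \<open>I1\<close>, so the two parts add up to \<open>F\<close> exactly.\<close>
  define I1 where "I1 s t = (if s \<le> t then F s t else 0)" for s t
  define I2 where "I2 s t = (if t < s then F s t else 0)" for s t
  have fs[measurable]: "(\<lambda>p. fst p) \<in> borel_measurable (M \<Otimes>\<^sub>M M)" "(\<lambda>p. snd p) \<in> borel_measurable (M \<Otimes>\<^sub>M M)"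
    using measurable_compose[OF measurable_fst id] measurable_compose[OF measurable_snd id] by auto
  have "{p \<in> space (M \<Otimes>\<^sub>M M). fst p \<le> snd p} \<in> sets (M \<Otimes>\<^sub>M M)"
      "{p \<in> space (M \<Otimes>\<^sub>M M). snd p < fst p} \<in> sets (M \<Otimes>\<^sub>M M)"
    by (rule borel_measurable_le[OF fs] borel_measurable_less[OF fs(2,1)])+
  then have [measurable]: "Measurable.pred (M \<Otimes>\<^sub>M M) (\<lambda>p. fst p \<le> snd p)"
      "Measurable.pred (M \<Otimes>\<^sub>M M) (\<lambda>p. snd p < fst p)"
    by (simp_all add: pred_def)
  have [measurable]: "(\<lambda>p. I1 (fst p) (snd p)) \<in> borel_measurable (M \<Otimes>\<^sub>M M)"
      "(\<lambda>p. I2 (fst p) (snd p)) \<in> borel_measurable (M \<Otimes>\<^sub>M M)"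
    unfolding I1_def I2_def F_def by measurable
  have F1: "integrable (M \<Otimes>\<^sub>M M) (\<lambda>(s,t). I1 s t)"
    by (rule Bochner_Integration.integrable_bound[OF F0])
       (simp_all add: case_prod_beta', simp add: I1_def)
  have F2: "integrable (M \<Otimes>\<^sub>M M) (\<lambda>(s,t). I2 s t)"
    by (rule Bochner_Integration.integrable_bound[OF F0])
       (simp_all add: case_prod_beta', simp add: I2_def)
  have xt: "x t = x 0 + integral {0..t} x'" and ix': "integral {0..t} x' = (LINT s|M. indicator {0..t} s *\<^sub>R x' s)"
    and ii: "integrable M (\<lambda>s. indicator {0..t} s *\<^sub>R x' s)"
    if "t \<in> {0..T}" for t
  proof -
    show "integral {0..t} x' = (LINT s|M. indicator {0..t} s *\<^sub>R x' s)"
      unfolding M_def by (rule primitive_eq_integral(2)) (use ix that M_def in auto)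
    show "x t = x 0 + integral {0..t} x'"
      using weak_derivative_eq[OF x that] .
    show "integrable M (\<lambda>s. indicator {0..t} s *\<^sub>R x' s)"
      by (rule Bochner_Integration.integrable_bound[OF ix]) (auto simp: indicator_def)
  qed
  have yt: "y t = y 0 + integral {0..t} y'" and iy': "integral {0..t} y' = (LINT s|M. indicator {0..t} s *\<^sub>R y' s)"
    and ji: "integrable M (\<lambda>s. indicator {0..t} s *\<^sub>R y' s)"
    if "t \<in> {0..T}" for t
  proof -
    show "integral {0..t} y' = (LINT s|M. indicator {0..t} s *\<^sub>R y' s)"
      unfolding M_def by (rule primitive_eq_integral(2)) (use iy that M_def in auto)
    show "y t = y 0 + integral {0..t} y'"
      using weak_derivative_eq[OF y that] .
    show "integrable M (\<lambda>s. indicator {0..t} s *\<^sub>R y' s)"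
      by (rule Bochner_Integration.integrable_bound[OF iy]) (auto simp: indicator_def)
  qed
  have ptx: "x t \<bullet> y' t = x 0 \<bullet> y' t + (LINT s|M. I1 s t)" if "t \<in> {0..T}" for t
  proof -
    have "(LINT s|M. indicator {0..t} s *\<^sub>R x' s) \<bullet> y' t = (LINT s|M. (indicator {0..t} s *\<^sub>R x' s) \<bullet> y' t)"
      by (rule integral_inner_left[symmetric]) (use ii[OF that] in auto)
    also have "\<dots> = (LINT s|M. I1 s t)"
      by (rule Bochner_Integration.integral_cong) (auto simp: sp I1_def F_def indicator_def)
    finally show ?thesis using xt[OF that] ix'[OF that] by (simp add: inner_add_left)
  qed
  \<comment> \<open>The indicator of {0..t} contains the end point t, whereas \<open>I2\<close>
    leaves the diagonal out; the two integrands agree only off this null set.\<close>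
  have AEne: "AE s in M. s \<noteq> t" for t
    using AE_completion[OF AE_lborel_singleton[of t]] unfolding M_def
    by (simp add: AE_restrict_space_iff) (auto elim: eventually_mono)
  have pty: "x' t \<bullet> y t = x' t \<bullet> y 0 + (LINT s|M. I2 t s)" if "t \<in> {0..T}" for t
  proof -
    have "x' t \<bullet> (LINT s|M. indicator {0..t} s *\<^sub>R y' s) = (LINT s|M. x' t \<bullet> (indicator {0..t} s *\<^sub>R y' s))"
      by (rule integral_inner_right[symmetric]) (use ji[OF that] in auto)
    also have "\<dots> = (LINT s|M. I2 t s)"
    proof (rule integral_cong_AE)
      have "{s \<in> space M. s < t} \<in> sets M" by (intro borel_measurable_less id) auto
      then have [measurable]: "Measurable.pred M (\<lambda>s. s < t)" by (simp add: pred_def)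
      show "(\<lambda>s. I2 t s) \<in> borel_measurable M" unfolding I2_def F_def by measurable
      show "AE s in M. x' t \<bullet> indicat_real {0..t} s *\<^sub>R y' s = I2 t s"
        using AEne[of t] AE_space[of M] by eventually_elim (auto simp: sp I2_def F_def indicator_def)
    qed auto
    finally show ?thesis using yt[OF that] iy'[OF that] by (simp add: inner_add_right)
  qed
  have J1: "integrable M (\<lambda>t. LINT s|M. I1 s t)" "(LINT t|M. LINT s|M. I1 s t) = (LINT p|(M \<Otimes>\<^sub>M M). I1 (fst p) (snd p))"
    using integrable_snd[OF F1] integral_snd[OF F1] by (auto simp: case_prod_beta')
  have J2: "integrable M (\<lambda>t. LINT s|M. I2 t s)" "(LINT t|M. LINT s|M. I2 t s) = (LINT p|(M \<Otimes>\<^sub>M M). I2 (fst p) (snd p))"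
    using integrable_fst[OF F2] integral_fst[OF F2] by (auto simp: case_prod_beta')
  have px: "integrable M (\<lambda>t. x t \<bullet> y' t)"
    by (subst Bochner_Integration.integrable_cong[OF refl ptx]) (use sp iy J1 in auto)
  have py: "integrable M (\<lambda>t. x' t \<bullet> y t)"
    by (subst Bochner_Integration.integrable_cong[OF refl pty]) (use sp ix J2 in auto)
  show "integrable (lebesgue_on {0..T}) (\<lambda>t. x' t \<bullet> y t)" "integrable (lebesgue_on {0..T}) (\<lambda>t. x t \<bullet> y' t)"
    using px py M_def by auto
  have e1: "(LINT t|M. x t \<bullet> y' t) = x 0 \<bullet> (LINT t|M. y' t) + (LINT p|(M \<Otimes>\<^sub>M M). I1 (fst p) (snd p))"
    by (subst Bochner_Integration.integral_cong[OF refl ptx]) (use sp iy J1 in auto)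
  have e2: "(LINT t|M. x' t \<bullet> y t) = (LINT t|M. x' t) \<bullet> y 0 + (LINT p|(M \<Otimes>\<^sub>M M). I2 (fst p) (snd p))"
    by (subst Bochner_Integration.integral_cong[OF refl pty]) (use sp ix J2 in auto)
  have "(LINT p|(M \<Otimes>\<^sub>M M). I1 (fst p) (snd p)) + (LINT p|(M \<Otimes>\<^sub>M M). I2 (fst p) (snd p))
      = (LINT p|(M \<Otimes>\<^sub>M M). I1 (fst p) (snd p) + I2 (fst p) (snd p))"
    using F1 F2 by (simp add: case_prod_beta')
  also have "\<dots> = (LINT p|(M \<Otimes>\<^sub>M M). F (fst p) (snd p))"
    by (rule Bochner_Integration.integral_cong) (auto simp: I1_def I2_def)
  also have "\<dots> = (LINT s|M. LINT t|M. F s t)"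
    using integral_fst[OF F0] by (simp add: case_prod_beta')
  also have "\<dots> = (LINT s|M. x' s \<bullet> (LINT t|M. y' t))"
    by (simp add: F_def iy)
  also have "\<dots> = (LINT t|M. x' t) \<bullet> (LINT t|M. y' t)"
    using ix by simp
  finally have e3: "(LINT p|(M \<Otimes>\<^sub>M M). I1 (fst p) (snd p)) + (LINT p|(M \<Otimes>\<^sub>M M). I2 (fst p) (snd p)) =
     (LINT t|M. x' t) \<bullet> (LINT t|M. y' t)" .
  have "x T = x 0 + (LINT t|M. x' t)" "y T = y 0 + (LINT t|M. y' t)"
    using x y T unfolding weak_derivative_def M_def by (meson atLeastAtMost_iff order_refl)+
  then show "x T \<bullet> y T - x 0 \<bullet> y 0 =
      (LINT t|lebesgue_on {0..T}. x' t \<bullet> y t) + (LINT t|lebesgue_on {0..T}. x t \<bullet> y' t)"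
    using e1 e2 e3 by (simp add: M_def[symmetric] inner_add_left inner_add_right)
qed

text \<open>At the point r where norm (y t) * exp (- 2 K t) is largest, the integral term is at most
  half of norm (y r) and can be absorbed into the left-hand side. The factor 2 and the doubled rate
  are the price of this absorption.\<close>

lemma gronwall_exp:
  fixes y :: "real \<Rightarrow> 'a::real_normed_vector"
  assumes "continuous_on {0..T} y" "0 < K" "0 \<le> \<alpha>"
    and le: "\<And>t. t \<in> {0..T} \<Longrightarrow> norm (y t) \<le> \<alpha> + K * integral {0..t} (\<lambda>s. norm (y s))"
    and t: "t \<in> {0..T}"
  shows "norm (y t) \<le> 2 * \<alpha> * exp (2 * K * t)"
proof -
  have "continuous_on {0..T} (\<lambda>s. norm (y s) * exp (- (2 * K * s)))"
    by (intro continuous_intros assms)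
  moreover have "{0..T} \<noteq> {}" using t by auto
  ultimately obtain r where r: "r \<in> {0..T}" and
    mx: "\<And>s. s \<in> {0..T} \<Longrightarrow> norm (y s) * exp (- (2 * K * s)) \<le> norm (y r) * exp (- (2 * K * r))"
    using continuous_attains_sup[of "{0..T}" "\<lambda>s. norm (y s) * exp (- (2 * K * s))"] by auto
  define m where "m = norm (y r) * exp (- (2 * K * r))"
  have ys: "norm (y s) \<le> m * exp (2 * K * s)" if "s \<in> {0..T}" for s
    using mx[OF that] unfolding m_def[symmetric] by (simp add: exp_minus field_simps)
  have hi: "((\<lambda>s. m * exp (2 * K * s)) has_integral (m * exp (2 * K * r) / (2 * K) - m * exp (2 * K * 0) / (2 * K))) {0..r}"
    by (rule fundamental_theorem_of_calculus)
       (use r \<open>0 < K\<close> in \<open>auto intro!: derivative_eq_intros simp: has_real_derivative_iff_has_vector_derivative[symmetric]\<close>)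
  have "integral {0..r} (\<lambda>s. norm (y s)) \<le> integral {0..r} (\<lambda>s. m * exp (2 * K * s))"
  proof (rule integral_le)
    show "(\<lambda>s. norm (y s)) integrable_on {0..r}"
      by (intro integrable_continuous_interval continuous_intros continuous_on_subset[OF assms(1)]) (use r in auto)
  qed (use hi ys r in \<open>auto simp: integrable_on_def\<close>)
  also have "\<dots> = m * exp (2 * K * r) / (2 * K) - m / (2 * K)"
    using integral_unique[OF hi] by simp
  finally have "K * integral {0..r} (\<lambda>s. norm (y s)) \<le> K * (m * exp (2 * K * r) / (2 * K) - m / (2 * K))"
    using \<open>0 < K\<close> by simp
  also have "\<dots> = m * exp (2 * K * r) / 2 - m / 2" using \<open>0 < K\<close> by (simp add: field_simps)
  finally have "norm (y r) \<le> \<alpha> + (m * exp (2 * K * r) / 2 - m / 2)"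
    using le[OF r] by simp
  moreover have "norm (y r) = m * exp (2 * K * r)" by (simp add: m_def exp_minus)
  moreover have "0 \<le> m" by (simp add: m_def)
  ultimately have "m * exp (2 * K * r) \<le> 2 * \<alpha>" by simp
  moreover have "m * 1 \<le> m * exp (2 * K * r)" using \<open>0 \<le> m\<close> r \<open>0 < K\<close> by (intro mult_left_mono) auto
  ultimately have "m \<le> 2 * \<alpha>" by simp
  then have "m * exp (2 * K * t) \<le> 2 * \<alpha> * exp (2 * K * t)" by (intro mult_right_mono) auto
  with ys[OF t] show ?thesis by (rule order_trans)
qed

section \<open>Caratheodory integrands and linear Volterra equations\<close>

text \<open>If g is simple, the composition consists of finitely many pieces of the form f t z with
  z fixed. Continuity in the second argument carries measurability over to a general g, a pointwise
  limit of simple functions.\<close>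

lemma borel_measurable_Caratheodory:
  fixes f :: "'t \<Rightarrow> 'a::{metric_space,second_countable_topology} \<Rightarrow> 'b::{metric_space,second_countable_topology}"
  assumes f: "\<And>z. (\<lambda>t. f t z) \<in> borel_measurable M"
    and cont: "\<And>t. t \<in> space M \<Longrightarrow> continuous_on UNIV (f t)"
    and g: "g \<in> borel_measurable M"
  shows "(\<lambda>t. f t (g t)) \<in> borel_measurable M"
proof -
  obtain s where s: "\<And>i. simple_function M (s i)" "\<And>t. t \<in> space M \<Longrightarrow> (\<lambda>i. s i t) \<longlonglongrightarrow> g t"
    using borel_measurable_implies_sequence_metric[OF g] by metis
  show ?thesis
  proof (rule borel_measurable_LIMSEQ_metric)
    fix i
    have "s i \<in> measurable M (count_space (s i ` space M))"
      using s(1)[of i] simple_functionD[OF s(1)[of i]] by (subst measurable_count_space_eq2) auto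
    then show "(\<lambda>t. f t (s i t)) \<in> borel_measurable M"
      by (rule measurable_compose_countable'[rotated])
         (use f simple_functionD(1)[OF s(1)[of i]] in \<open>auto intro: countable_finite\<close>)
  next
    fix t assume "t \<in> space M"
    then show "(\<lambda>i. f t (s i t)) \<longlonglongrightarrow> f t (g t)"
      by (intro continuous_on_tendsto_compose[OF cont s(2)]) auto
  qed
qed

text \<open>Lebesgue measure is complete, so changing a measurable function on a null set is
  harmless. Extension by 0 moves the question from the restricted measure to
  \<open>lebesgue\<close>.\<close>

lemma borel_measurable_lebesgue_on_cong_AE:
  fixes f g :: "'a::euclidean_space \<Rightarrow> 'b::euclidean_space"
  assumes S: "S \<in> sets lebesgue" and f: "f \<in> borel_measurable (lebesgue_on S)"
    and ae: "AE t in lebesgue_on S. f t = g t"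
  shows "g \<in> borel_measurable (lebesgue_on S)"
proof -
  have "(\<lambda>t. if t \<in> S then f t else 0) \<in> borel_measurable lebesgue"
    using f S by (simp add: borel_measurable_if)
  moreover have "AE t in lebesgue. (if t \<in> S then f t else 0) = (if t \<in> S then g t else 0)"
    using ae S by (simp add: AE_restrict_space_iff)
  ultimately have "(\<lambda>t. if t \<in> S then g t else 0) \<in> borel_measurable lebesgue"
    by (rule borel_measurable_AE)
  then show ?thesis using S by (simp add: borel_measurable_if)
qed

lemma borel_measurable_Caratheodory_AE:
  fixes f :: "'t::euclidean_space \<Rightarrow> 'a::{metric_space,second_countable_topology} \<Rightarrow> 'b::euclidean_space"
  assumes S: "S \<in> sets lebesgue"
    and f: "\<And>z. (\<lambda>t. f t z) \<in> borel_measurable (lebesgue_on S)"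
    and cont: "AE t in lebesgue_on S. continuous_on UNIV (f t)"
    and g: "g \<in> borel_measurable (lebesgue_on S)"
  shows "(\<lambda>t. f t (g t)) \<in> borel_measurable (lebesgue_on S)"
proof -
  \<comment> \<open>The zero function is put in on the null set of times with discontinuous
    \<open>f t\<close>, so that continuity holds at every time.\<close>
  define f' where "f' t = (if continuous_on UNIV (f t) then f t else (\<lambda>_. 0))" for t
  have ae: "AE t in lebesgue_on S. f t = f' t"
    using cont by eventually_elim (simp add: f'_def)
  have "(\<lambda>t. f' t (g t)) \<in> borel_measurable (lebesgue_on S)"
  proof (rule borel_measurable_Caratheodory[OF _ _ g])
    show "(\<lambda>t. f' t z) \<in> borel_measurable (lebesgue_on S)" for z
      by (rule borel_measurable_lebesgue_on_cong_AE[OF S f])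
         (use ae in \<open>eventually_elim, simp\<close>)
    show "continuous_on UNIV (f' t)" for t by (simp add: f'_def)
  qed
  then show ?thesis
    by (rule borel_measurable_lebesgue_on_cong_AE[OF S]) (use ae in \<open>eventually_elim, simp\<close>)
qed

section \<open>Measurability and bounds for matrix-valued coefficients\<close>

lemma bounded_bilinear_matrix_vector_mult:
  "bounded_bilinear (\<lambda>(A::real^'n^'m) x. A *v x)"
  unfolding bilinear_conv_bounded_bilinear[symmetric] bilinear_def
  by (auto intro!: linearI simp: matrix_vector_mult_add_rdistrib matrix_vector_right_distrib
      scaleR_matrix_vector_assoc matrix_vector_mult_scaleR)

lemma borel_measurable_matrix_vector_mult [measurable (raw)]:
  fixes A :: "'t \<Rightarrow> real^'n^'m"
  assumes "A \<in> borel_measurable M" "x \<in> borel_measurable M"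
  shows "(\<lambda>t. A t *v x t) \<in> borel_measurable M"
  using assms
  by (rule borel_measurable_continuous_Pair)
     (intro bounded_bilinear.continuous_on[OF bounded_bilinear_matrix_vector_mult] continuous_intros)

lemma bounded_measurable_matrix_boundE:
  assumes "bounded_measurable T (A :: real \<Rightarrow> real^'n^'m)"
  obtains K where "0 < K" "\<And>t x. t \<in> {0..T} \<Longrightarrow> norm (A t *v x) \<le> K * norm x"
proof -
  obtain a where a: "\<And>t. t \<in> {0..T} \<Longrightarrow> norm (A t) \<le> a" "0 < a"
    using assms unfolding bounded_measurable_def bounded_pos by blast
  obtain b where b: "0 < b" "\<And>(A::real^'n^'m) x. norm (A *v x) \<le> norm A * norm x * b"
    using bounded_bilinear.pos_bounded[OF bounded_bilinear_matrix_vector_mult] by blast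
  show thesis
  proof
    show "0 < a * b" using a b by simp
    fix t and x :: "real^'n" assume "t \<in> {0..T}"
    then have "norm (A t) * norm x * b \<le> a * norm x * b"
      using a b by (intro mult_right_mono) auto
    then show "norm (A t *v x) \<le> a * b * norm x"
      using b(2)[of "A t" x] by (simp add: ac_simps)
  qed
qed

lemma integrable_lebesgue_on_bounded:
  fixes v :: "real \<Rightarrow> 'a::euclidean_space"
  assumes "v \<in> borel_measurable (lebesgue_on {0..T})" "AE t in lebesgue_on {0..T}. norm (v t) \<le> C"
  shows "integrable (lebesgue_on {0..T}) v"
  by (rule finite_measure.integrable_const_bound[OF finite_measure_lebesgue_on]) (use assms in auto)

lemma borel_measurable_lebesgue_on_continuous:
  fixes y :: "real \<Rightarrow> 'a::euclidean_space"
  assumes "continuous_on {0..T} y"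
  shows "y \<in> borel_measurable (lebesgue_on {0..T})"
  by (rule continuous_imp_measurable_on_sets_lebesgue[OF assms]) auto

lemma integrable_on_lebesgue_on_interval:
  fixes v :: "real \<Rightarrow> 'a::euclidean_space"
  assumes "integrable (lebesgue_on {0..T}) v" "{a..b} \<subseteq> {0..T}"
  shows "v integrable_on {a..b}"
proof -
  have "set_integrable lebesgue {0..T} v"
    using assms(1) by (simp add: integrable_restrict_space set_integrable_def)
  then have "v integrable_on {0..T}" by (rule set_lebesgue_integral_eq_integral)
  then show ?thesis using assms(2) by (rule integrable_on_subinterval)
qed

text \<open>Picard iteration contracts by \<open>1/2\<close> in the sup norm weighted by \<open>1/w\<close>; both integration from
  the left (\<open>w t = exp (2Kt)\<close>) and from the right (\<open>w t = exp (- 2Kt)\<close>) are needed.\<close>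
lemma linear_Volterra_exists:
  fixes A :: "real \<Rightarrow> real^'n^'n"
  assumes T: "0 \<le> T"
    and A: "A \<in> borel_measurable (lebesgue_on {0..T})"
    and K: "\<And>s x. s \<in> {0..T} \<Longrightarrow> norm (A s *v x) \<le> K * norm x" "0 < K"
    and g: "continuous_on {0..T} g"
    and w: "continuous_on UNIV w" "\<And>t. 0 < w t"
    and I: "\<And>t. t \<in> {0..T} \<Longrightarrow> {lo t..hi t} \<subseteq> {0..T}"
    and Icont: "\<And>v::real \<Rightarrow> real^'n. v integrable_on {0..T} \<Longrightarrow> continuous_on {0..T} (\<lambda>t. integral {lo t..hi t} v)"
    and wI: "\<And>t. t \<in> {0..T} \<Longrightarrow> K * integral {lo t..hi t} w \<le> w t / 2"
  obtains y where "continuous_on {0..T} y"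
    "\<And>t. t \<in> {0..T} \<Longrightarrow> y t = g t + integral {lo t..hi t} (\<lambda>s. A s *v y s)"
proof -
  \<comment> \<open>Clamping time to [0,T]: the Banach space used for the fixed point consists of
    bounded continuous functions on the whole line.\<close>
  define c where "c r = max 0 (min T r)" for r
  have c: "c r \<in> {0..T}" "r \<in> {0..T} \<Longrightarrow> c r = r" for r using T by (auto simp: c_def)
  \<comment> \<open>The unknown y stands for the solution divided by w, so that the ordinary sup
    norm of y is the weighted norm of the solution.\<close>
  define F where "F y t = (1 / w t) *\<^sub>R (g t + integral {lo t..hi t} (\<lambda>s. A s *v (w s *\<^sub>R y s)))" for y t
  have int: "integrable (lebesgue_on {0..T}) (\<lambda>s. A s *v (w s *\<^sub>R y s))" if "continuous_on UNIV y" for y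
  proof -
    have co: "continuous_on {0..T} (\<lambda>s. w s *\<^sub>R y s)"
      using w that by (auto intro!: continuous_intros intro: continuous_on_subset)
    then have "compact ((\<lambda>s. w s *\<^sub>R y s) ` {0..T})" by (rule compact_continuous_image) auto
    then obtain C where C: "\<And>s. s \<in> {0..T} \<Longrightarrow> norm (w s *\<^sub>R y s) \<le> C"
      using compact_imp_bounded[of "(\<lambda>s. w s *\<^sub>R y s) ` {0..T}"] unfolding bounded_iff by (metis imageI)
    show ?thesis
    proof (rule integrable_lebesgue_on_bounded[where C="K * C"])
      show "(\<lambda>s. A s *v (w s *\<^sub>R y s)) \<in> borel_measurable (lebesgue_on {0..T})"
        using A borel_measurable_lebesgue_on_continuous[OF co] by measurable
      show "AE t in lebesgue_on {0..T}. norm (A t *v (w t *\<^sub>R y t)) \<le> K * C"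
      proof (rule AE_I2)
        fix t assume "t \<in> space (lebesgue_on {0..T})"
        then have t: "t \<in> {0..T}" by simp
        show "norm (A t *v (w t *\<^sub>R y t)) \<le> K * C"
          using K(1)[OF t, of "w t *\<^sub>R y t"] mult_left_mono[OF C[OF t], of K] K(2) by linarith
      qed
    qed
  qed
  have inton: "(\<lambda>s. A s *v (w s *\<^sub>R y s)) integrable_on {lo t..hi t}" if "continuous_on UNIV y" "t \<in> {0..T}" for y t
    using integrable_on_lebesgue_on_interval[OF int[OF that(1)] I[OF that(2)]] .
  have contF: "continuous_on {0..T} (F y)" if "continuous_on UNIV y" for y
  proof -
    have "(\<lambda>s. A s *v (w s *\<^sub>R y s)) integrable_on {0..T}"
      using integrable_on_lebesgue_on_interval[OF int[OF that]] by blast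
    then show ?thesis unfolding F_def
      by (intro continuous_intros g Icont continuous_on_subset[OF w(1)]) (use w(2) in \<open>auto simp: less_imp_neq[symmetric]\<close>)
  qed
  have Fb: "(\<lambda>r. F y (c r)) \<in> bcontfun" if "continuous_on UNIV y" for y
  proof -
    have "continuous_on UNIV (\<lambda>r. F y (c r))"
      by (rule continuous_on_compose2[OF contF[OF that]]) (use c in \<open>auto simp: c_def intro!: continuous_intros\<close>)
    moreover have "bounded (range (\<lambda>r. F y (c r)))"
      by (rule bounded_subset[OF compact_imp_bounded[OF compact_continuous_image[OF contF[OF that]]]])
         (use c in auto)
    ultimately show ?thesis by (simp add: bcontfun_def)
  qed
  define \<Phi> where "\<Phi> y = Bcontfun (\<lambda>r. F (apply_bcontfun y) (c r))" for y :: "real \<Rightarrow>\<^sub>C (real^'n)"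
  have \<Phi>: "apply_bcontfun (\<Phi> y) r = F (apply_bcontfun y) (c r)" for y r
    unfolding \<Phi>_def by (subst Bcontfun_inverse) (auto intro: Fb)
  have "\<exists>!y. \<Phi> y = y"
  proof (rule banach_fix_type)
    show "\<forall>y z. dist (\<Phi> y) (\<Phi> z) \<le> 1/2 * dist y z"
    proof (intro allI dist_bound)
      fix y z :: "real \<Rightarrow>\<^sub>C (real^'n)" and r
      define t where "t = c r"
      have t: "t \<in> {0..T}" using c t_def by auto
      have iy: "(\<lambda>s. A s *v (w s *\<^sub>R y s)) integrable_on {lo t..hi t}"
        by (rule inton) (use t in auto)
      have iz: "(\<lambda>s. A s *v (w s *\<^sub>R z s)) integrable_on {lo t..hi t}"
        by (rule inton) (use t in auto)
      have "norm (integral {lo t..hi t} (\<lambda>s. A s *v (w s *\<^sub>R y s)) - integral {lo t..hi t} (\<lambda>s. A s *v (w s *\<^sub>R z s)))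
         = norm (integral {lo t..hi t} (\<lambda>s. A s *v (w s *\<^sub>R y s) - A s *v (w s *\<^sub>R z s)))"
        by (simp only: Henstock_Kurzweil_Integration.integral_diff[OF iy iz])
      also have "\<dots> \<le> integral {lo t..hi t} (\<lambda>s. K * dist y z * w s)"
      proof (rule integral_norm_bound_integral)
        show "(\<lambda>s. A s *v (w s *\<^sub>R y s) - A s *v (w s *\<^sub>R z s)) integrable_on {lo t..hi t}"
          using iy iz by (rule Henstock_Kurzweil_Integration.integrable_diff)
        show "(\<lambda>s. K * dist y z * w s) integrable_on {lo t..hi t}"
          by (intro integrable_continuous_interval continuous_intros continuous_on_subset[OF w(1)]) auto
        fix s assume "s \<in> {lo t..hi t}"
        then have s: "s \<in> {0..T}" using I[OF t] by blast
        have "norm (A s *v (w s *\<^sub>R y s) - A s *v (w s *\<^sub>R z s)) = norm (A s *v (w s *\<^sub>R (y s - z s)))"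
          by (simp add: matrix_vector_mult_diff_distrib scaleR_diff_right)
        also have "\<dots> \<le> K * norm (w s *\<^sub>R (y s - z s))" using K(1)[OF s] .
        also have "\<dots> = K * (w s * dist (y s) (z s))" using w(2)[of s] by (simp add: dist_norm)
        also have "\<dots> \<le> K * (w s * dist y z)"
          using w(2)[of s] K(2) dist_bounded[of y s z] by (intro mult_left_mono) auto
        finally show "norm (A s *v (w s *\<^sub>R y s) - A s *v (w s *\<^sub>R z s)) \<le> K * dist y z * w s"
          by (simp add: ac_simps)
      qed
      also have "\<dots> = dist y z * (K * integral {lo t..hi t} w)" by simp
      also have "\<dots> \<le> dist y z * (w t / 2)" by (intro mult_left_mono wI t) simp
      finally have *: "norm (integral {lo t..hi t} (\<lambda>s. A s *v (w s *\<^sub>R y s)) - integral {lo t..hi t} (\<lambda>s. A s *v (w s *\<^sub>R z s)))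
         \<le> dist y z * (w t / 2)" .
      have "dist (F y t) (F z t) = (1 / w t) * norm (integral {lo t..hi t} (\<lambda>s. A s *v (w s *\<^sub>R y s)) - integral {lo t..hi t} (\<lambda>s. A s *v (w s *\<^sub>R z s)))"
        using w(2)[of t] by (simp add: F_def dist_norm flip: scaleR_diff_right)
      also have "\<dots> \<le> (1 / w t) * (dist y z * (w t / 2))"
        using * w(2)[of t] by (intro mult_left_mono) auto
      also have "\<dots> = 1/2 * dist y z" using w(2)[of t] by simp
      finally show "dist (\<Phi> y r) (\<Phi> z r) \<le> 1/2 * dist y z" by (simp add: \<Phi> t_def)
    qed
  qed auto
  then obtain y where y: "\<Phi> y = y" by blast
  show thesis
  proof
    show "continuous_on {0..T} (\<lambda>s. w s *\<^sub>R y s)"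
      by (intro continuous_intros continuous_on_subset[OF w(1)]) auto
    fix t assume t: "t \<in> {0..T}"
    have "y t = F y t" using \<Phi>[of y t] y c(2)[OF t] by simp
    then show "w t *\<^sub>R y t = g t + integral {lo t..hi t} (\<lambda>s. A s *v (w s *\<^sub>R y s))"
      using w(2)[of t] by (simp add: F_def)
  qed
qed

section \<open>Linear equations with given initial or terminal value\<close>

lemma has_integral_exp_interval:
  fixes k :: real
  assumes "a \<le> b" "k \<noteq> 0"
  shows "((\<lambda>s. exp (k * s)) has_integral (exp (k * b) / k - exp (k * a) / k)) {a..b}"
  by (rule fundamental_theorem_of_calculus)
     (use assms in \<open>auto intro!: derivative_eq_intros simp: has_real_derivative_iff_has_vector_derivative[symmetric]\<close>)

lemma linear_Volterra_forward:
  fixes A :: "real \<Rightarrow> real^'n^'n"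
  assumes T: "0 \<le> T" and A: "bounded_measurable T A" and g: "continuous_on {0..T} g"
  obtains y where "continuous_on {0..T} y"
    "\<And>t. t \<in> {0..T} \<Longrightarrow> y t = g t + integral {0..t} (\<lambda>s. A s *v y s)"
proof -
  obtain K where K: "0 < K" "\<And>t x. t \<in> {0..T} \<Longrightarrow> norm (A t *v x) \<le> K * norm x"
    using bounded_measurable_matrix_boundE[OF A] by blast
  show thesis
  proof (rule linear_Volterra_exists[where A=A and g=g and w="\<lambda>t. exp ((2 * K) * t)" and lo="\<lambda>_. 0" and hi="\<lambda>t. t", OF T _ K(2) K(1) g])
    show "A \<in> borel_measurable (lebesgue_on {0..T})" using A by (simp add: bounded_measurable_def)
    show "continuous_on {0..T} (\<lambda>t. integral {0..t} v)"
      if "v integrable_on {0..T}" for v :: "real \<Rightarrow> real^'n"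
      using that by (rule indefinite_integral_continuous_1)
    show "K * integral {0..t} (\<lambda>t. exp (2 * K * t)) \<le> exp (2 * K * t) / 2" if "t \<in> {0..T}" for t
      using has_integral_exp_interval[of 0 t "2 * K", THEN integral_unique] that K(1) by (simp add: field_simps)
  qed (auto intro!: continuous_intros that)
qed

lemma linear_Volterra_backward:
  fixes A :: "real \<Rightarrow> real^'n^'n"
  assumes T: "0 \<le> T" and A: "bounded_measurable T A" and g: "continuous_on {0..T} g"
  obtains y where "continuous_on {0..T} y"
    "\<And>t. t \<in> {0..T} \<Longrightarrow> y t = g t + integral {t..T} (\<lambda>s. A s *v y s)"
proof -
  obtain K where K: "0 < K" "\<And>t x. t \<in> {0..T} \<Longrightarrow> norm (A t *v x) \<le> K * norm x"
    using bounded_measurable_matrix_boundE[OF A] by blast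
  show thesis
  proof (rule linear_Volterra_exists[where A=A and g=g and w="\<lambda>t. exp ((- 2 * K) * t)" and lo="\<lambda>t. t" and hi="\<lambda>_. T", OF T _ K(2) K(1) g])
    show "A \<in> borel_measurable (lebesgue_on {0..T})" using A by (simp add: bounded_measurable_def)
    show "continuous_on {0..T} (\<lambda>t. integral {t..T} v)"
      if "v integrable_on {0..T}" for v :: "real \<Rightarrow> real^'n"
      using that by (rule indefinite_integral_continuous_1')
    show "K * integral {t..T} (\<lambda>t. exp (- 2 * K * t)) \<le> exp (- 2 * K * t) / 2" if "t \<in> {0..T}" for t
    proof -
      have "K * integral {t..T} (\<lambda>t. exp (- 2 * K * t)) = (exp (- 2 * K * t) - exp (- 2 * K * T)) / 2"
        using has_integral_exp_interval[of t T "- 2 * K", THEN integral_unique] that K(1)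
        by (simp add: field_simps)
      also have "\<dots> \<le> exp (- 2 * K * t) / 2" by (intro divide_right_mono) auto
      finally show ?thesis .
    qed
  qed (auto intro!: continuous_intros that)
qed

section \<open>Gradients of concave functions\<close>

lemma GDERIV_imp_directional:
  fixes g :: "'a::real_inner \<Rightarrow> real"
  assumes "GDERIV g z :> D"
  shows "((\<lambda>\<theta>::real. g (z + \<theta> *\<^sub>R h)) has_real_derivative (h \<bullet> D)) (at 0)"
proof -
  have "((\<lambda>\<theta>::real. g (z + \<theta> *\<^sub>R h)) has_derivative (\<lambda>\<theta>. (\<theta> *\<^sub>R h) \<bullet> D)) (at 0)"
    by (rule has_derivative_compose[where f="\<lambda>\<theta>. z + \<theta> *\<^sub>R h" and g=g and g'="\<lambda>h. h \<bullet> D"])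
       (use assms in \<open>auto intro!: derivative_eq_intros simp: gderiv_def\<close>)
  then show ?thesis by (simp add: has_field_derivative_def mult.commute[of _ "h \<bullet> D"])
qed

text \<open>Fixing the step sizes 1/(n+1) turns the derivative into a limit of a sequence, the form
  in which measurability of limits and monotone convergence apply.\<close>

lemma GDERIV_imp_LIMSEQ:
  fixes g :: "'a::real_inner \<Rightarrow> real"
  assumes "GDERIV g z :> D"
  shows "(\<lambda>n. (g (z + (1 / Suc n) *\<^sub>R h) - g z) * Suc n) \<longlonglongrightarrow> h \<bullet> D"
proof -
  have "((\<lambda>\<theta>::real. (g (z + \<theta> *\<^sub>R h) - g z) / \<theta>) \<longlongrightarrow> h \<bullet> D) (at 0)"
    using GDERIV_imp_directional[OF assms, of h] by (simp add: has_field_derivative_iff)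
  moreover have "filterlim (\<lambda>n. 1 / real (Suc n)) (at 0) sequentially"
    unfolding filterlim_at using LIMSEQ_inverse_real_of_nat by (auto simp: inverse_eq_divide)
  ultimately have "(\<lambda>n. (g (z + (1 / real (Suc n)) *\<^sub>R h) - g z) / (1 / real (Suc n))) \<longlonglongrightarrow> h \<bullet> D"
    by (rule filterlim_compose)
  then show ?thesis by simp
qed

text \<open>The point at step \<eta> is the convex combination with weight \<eta>/\<theta> of z and
  the point at step \<theta>. As \<eta> tends to 0 this yields the gradient inequality; along the
  steps 1/(n+1) it yields the increasing integrands of the necessity proof.\<close>

lemma concave_on_difference_quotient_antimono:
  fixes g :: "'a::real_inner \<Rightarrow> real"
  assumes "concave_on S g" "z \<in> S" "z + \<theta> *\<^sub>R h \<in> S" "0 < \<eta>" "\<eta> \<le> (\<theta>::real)"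
  shows "(g (z + \<theta> *\<^sub>R h) - g z) / \<theta> \<le> (g (z + \<eta> *\<^sub>R h) - g z) / \<eta>"
proof -
  define s where "s = \<eta> / \<theta>"
  have s: "0 \<le> s" "s \<le> 1" "s * \<theta> = \<eta>" using assms by (auto simp: s_def)
  have "(1 - s) * g z + s * g (z + \<theta> *\<^sub>R h) \<le> g ((1 - s) *\<^sub>R z + s *\<^sub>R (z + \<theta> *\<^sub>R h))"
    using assms(1,2,3) s unfolding concave_on_iff by simp
  also have "(1 - s) *\<^sub>R z + s *\<^sub>R (z + \<theta> *\<^sub>R h) = z + \<eta> *\<^sub>R h"
    using s by (simp add: algebra_simps)
  finally have "s * (g (z + \<theta> *\<^sub>R h) - g z) \<le> g (z + \<eta> *\<^sub>R h) - g z" by (simp add: algebra_simps)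
  then show ?thesis using assms by (simp add: s_def field_simps)
qed

lemma concave_on_le_gradient:
  fixes g :: "'a::real_inner \<Rightarrow> real"
  assumes "concave_on UNIV g" "GDERIV g z :> D"
  shows "g y \<le> g z + (y - z) \<bullet> D"
proof -
  have "g (z + 1 *\<^sub>R (y - z)) - g z \<le> (g (z + (1 / Suc n) *\<^sub>R (y - z)) - g z) * Suc n" for n
    using concave_on_difference_quotient_antimono[OF assms(1), of z 1 "y - z" "1 / Suc n"] by simp
  then have "g y - g z \<le> (y - z) \<bullet> D"
    by (intro LIMSEQ_le_const[OF GDERIV_imp_LIMSEQ[OF assms(2)]]) auto
  then show ?thesis by simp
qed

lemma GDERIV_gradient: "GDERIV g z :> D \<Longrightarrow> gradient g z = D"
  unfolding gradient_def
proof (rule the_equality)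
  fix D' assume "GDERIV g z :> D" "GDERIV g z :> D'"
  then have "(\<lambda>h. h \<bullet> D') = (\<lambda>h. h \<bullet> D)" unfolding gderiv_def by (rule has_derivative_unique[rotated])
  then have "(D' - D) \<bullet> D' = (D' - D) \<bullet> D" by meson
  then have "(D' - D) \<bullet> (D' - D) = 0" by (simp add: inner_diff_right)
  then show "D' = D" by simp
qed

lemma C1_imp_GDERIV: "C1 g \<Longrightarrow> GDERIV g z :> gradient g z"
  unfolding C1_def by (metis GDERIV_gradient)

section \<open>Strong limits of minimising sequences\<close>

text \<open>Sum and integral of nonnegative functions commute, so the series has finite integral and
  is finite almost everywhere.\<close>

lemma AE_summable_if_summable_integral:
  fixes f :: "nat \<Rightarrow> 'a \<Rightarrow> real"
  assumes int: "\<And>k. integrable M (f k)" and nn: "\<And>k x. 0 \<le> f k x"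
    and s: "summable (\<lambda>k. LINT x|M. f k x)"
  shows "AE x in M. summable (\<lambda>k. f k x)"
proof -
  have [measurable]: "f k \<in> borel_measurable M" for k using int by auto
  have "(\<integral>\<^sup>+x. (\<Sum>k. ennreal (f k x)) \<partial>M) = (\<Sum>k. \<integral>\<^sup>+x. ennreal (f k x) \<partial>M)"
    by (rule nn_integral_suminf) simp
  also have "\<dots> = (\<Sum>k. ennreal (LINT x|M. f k x))"
    using nn_integral_eq_integral[OF int] nn by simp
  also have "\<dots> \<noteq> \<infinity>"
    using s nn by (simp add: suminf_ennreal_eq[OF _ summable_sums[OF s]])
  finally have "AE x in M. (\<Sum>k. ennreal (f k x)) \<noteq> \<infinity>"
    by (intro nn_integral_PInf_AE) auto
  then show ?thesis
    by eventually_elim (use nn summable_suminf_not_top in auto)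
qed

text \<open>Elements of almost minimal \<open>L\<^sup>2\<close> norm in a decreasing sequence of bounded convex sets form an
  \<open>L\<^sup>2\<close> Cauchy sequence, by the parallelogram law. This yields strong limits where one would expect
  weak-* compactness.\<close>
lemma nested_midpoint_convex_AE_convergent:
  fixes K :: "nat \<Rightarrow> ('t \<Rightarrow> 'a::euclidean_space) set"
  assumes "finite_measure M"
    and ne: "\<And>n. K n \<noteq> {}" and dec: "\<And>m n. m \<le> n \<Longrightarrow> K n \<subseteq> K m"
    and meas: "\<And>n u. u \<in> K n \<Longrightarrow> u \<in> borel_measurable M"
    and bdd: "\<And>n u. u \<in> K n \<Longrightarrow> AE t in M. norm (u t) \<le> R"
    and mid: "\<And>n u v. u \<in> K n \<Longrightarrow> v \<in> K n \<Longrightarrow> (\<lambda>t. (1/2) *\<^sub>R (u t + v t)) \<in> K n"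
  obtains u where "\<And>n. u n \<in> K n" "AE t in M. convergent (\<lambda>n. u n t)"
proof -
  interpret finite_measure M by fact
  define q where "q u = (LINT t|M. (norm (u t))\<^sup>2)" for u :: "'t \<Rightarrow> 'a"
  have qint: "integrable M (\<lambda>t. (norm (u t))\<^sup>2)" if "u \<in> borel_measurable M" "AE t in M. norm (u t) \<le> r" for r and u :: "'t \<Rightarrow> 'a"
  proof (rule integrable_const_bound)
    show "AE t in M. norm ((norm (u t))\<^sup>2) \<le> r\<^sup>2"
      using that(2) by eventually_elim (auto intro: power_mono)
  qed (use that in measurable)
  define B where "B = R\<^sup>2 * measure M (space M)"
  have qB: "q u \<le> B" if "u \<in> K n" for u n
  proof -
    have "q u \<le> (LINT t|M. R\<^sup>2)" unfolding q_def
    proof (rule integral_mono_AE[OF qint])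
      show "AE t in M. (norm (u t))\<^sup>2 \<le> R\<^sup>2"
        using bdd[OF that] by eventually_elim (auto intro: power_mono)
    qed (use meas bdd that in auto)
    then show ?thesis by (simp add: B_def mult.commute)
  qed
  have q0: "0 \<le> q u" for u by (simp add: q_def)
  have bb: "bdd_below (q ` K n)" for n using q0 by (intro bdd_belowI[of _ 0]) auto
  define d where "d n = Inf (q ` K n)" for n
  have dle: "d n \<le> q u" if "u \<in> K n" for u n
    unfolding d_def using bb that by (auto intro: cInf_lower)
  have "d n \<le> B" for n using ne[of n] dle qB by (meson ex_in_conv order_trans)
  then have bd: "bdd_above (range d)" by (intro bdd_aboveI[of _ B]) auto
  define D where "D = (SUP n. d n)"
  have dD: "d n \<le> D" for n unfolding D_def using bd by (intro cSUP_upper) auto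
  \<comment> \<open>The ratio 1/8 is small enough that the increments, whose squared L2 norms will
    be at most 8 * e k, remain summable after multiplication by 2^k.\<close>
  define e where "e k = (1/8::real)^k" for k
  have e: "0 < e k" "e (Suc k) \<le> e k" for k by (auto simp: e_def)
  \<comment> \<open>The index is taken so late that the infimum is within e k of its limit D, and at
    least k so that the chosen element still lies in \<open>K k\<close>.\<close>
  have "\<exists>n\<ge>k. D - e k < d n" for k
  proof -
    obtain n where n: "D - e k < d n"
      using less_cSUP_iff[OF _ bd, of "D - e k"] e(1)[of k] unfolding D_def by auto
    have "d n \<le> d (max n k)" unfolding d_def
      using ne[of "max n k"] bb dec[of n "max n k"] by (intro cInf_superset_mono) auto
    then show ?thesis using n by (intro exI[of _ "max n k"]) auto
  qed
  then obtain N where N: "\<And>k. k \<le> N k" "\<And>k. D - e k < d (N k)" by metis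
  have "\<exists>u\<in>K (N k). q u < D + e k" for k
  proof -
    have "\<exists>x\<in>q ` K (N k). x < d (N k) + e k"
      unfolding d_def using ne[of "N k"] bb e(1)[of k]
      by (subst cInf_less_iff[symmetric]) auto
    then obtain v where v: "v \<in> K (N k)" "q v < d (N k) + e k" by blast
    from v(2) dD[of "N k"] have "q v < D + e k" by linarith
    then show ?thesis using v(1) by (rule bexI[of _ v])
  qed
  then obtain u where u: "\<And>k. u k \<in> K (N k)" "\<And>k. q (u k) < D + e k" by metis
  have uK: "u k \<in> K k" for k using u(1) dec[OF N(1)] by blast
  have um[measurable]: "u k \<in> borel_measurable M" for k using meas[OF uK] .
  have ub: "AE t in M. norm (u k t) \<le> R" for k using bdd[OF uK] .
  have dint: "integrable M (\<lambda>t. (norm (u (Suc k) t - u k t))\<^sup>2)" for k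
  proof (rule qint[where r="2 * R"])
    show "AE t in M. norm (u (Suc k) t - u k t) \<le> 2 * R"
      using ub[of k] ub[of "Suc k"] by eventually_elim norm
  qed measurable
  have step: "(LINT t|M. (norm (u (Suc k) t - u k t))\<^sup>2) \<le> 8 * e k" for k
  proof -
    define m where "m t = (1/2) *\<^sub>R (u (Suc k) t + u k t)" for t
    \<comment> \<open>The sets decrease, so both elements lie in the larger one, \<open>K j\<close>,
      and so does their midpoint. Whichever index is the minimum, \<open>d j\<close> exceeds D - e
      k.\<close>
    define j where "j = min (N k) (N (Suc k))"
    have "u k \<in> K j" "u (Suc k) \<in> K j" using u(1) dec[of j] unfolding j_def by (meson min.cobounded1 min.cobounded2 dec subsetD)+
    then have mj: "m \<in> K j" unfolding m_def[abs_def] using mid by blast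
    have "d j > D - e k" using N(2)[of k] N(2)[of "Suc k"] e(2)[of k] by (auto simp: j_def min_def)
    with dle[OF mj] have qm: "q m > D - e k" by simp
    have mint: "integrable M (\<lambda>t. (norm (m t))\<^sup>2)" by (rule qint[OF meas[OF mj] bdd[OF mj]])
    \<comment> \<open>Both elements have q below D + e k and the midpoint has q above D - e k; the
      parallelogram law leaves 2 (D + e k) + 2 (D + e k) - 4 (D - e k) = 8 e k.\<close>
    have "(LINT t|M. (norm (u (Suc k) t - u k t))\<^sup>2) + 4 * q m
        = (LINT t|M. (norm (u (Suc k) t - u k t))\<^sup>2 + 4 * (norm (m t))\<^sup>2)"
      using dint[of k] mint by (simp add: q_def)
    also have "\<dots> = (LINT t|M. 2 * (norm (u (Suc k) t))\<^sup>2 + 2 * (norm (u k t))\<^sup>2)"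
      by (rule Bochner_Integration.integral_cong)
         (auto simp: m_def power_mult_distrib power_divide power2_norm_eq_inner inner_add_left inner_add_right inner_diff_left inner_diff_right inner_commute field_simps)
    also have "\<dots> = 2 * q (u (Suc k)) + 2 * q (u k)"
      using qint[OF um ub] by (simp add: q_def)
    finally show ?thesis using u(2)[of k] u(2)[of "Suc k"] qm e(2)[of k] by simp
  qed
  have "AE t in M. summable (\<lambda>k. 2^k * (norm (u (Suc k) t - u k t))\<^sup>2)"
  proof (rule AE_summable_if_summable_integral)
    show "summable (\<lambda>k. LINT t|M. 2^k * (norm (u (Suc k) t - u k t))\<^sup>2)"
    proof (rule summable_comparison_test')
      show "summable (\<lambda>k. 8 * (1/4::real)^k)" by (intro summable_mult summable_geometric) auto
      fix k
      have "(LINT t|M. 2^k * (norm (u (Suc k) t - u k t))\<^sup>2) \<le> 2^k * (8 * e k)"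
        using step[of k] by simp
      also have "\<dots> = 8 * (1/4)^k" by (simp add: e_def flip: power_mult_distrib)
      finally show "norm (LINT t|M. 2^k * (norm (u (Suc k) t - u k t))\<^sup>2) \<le> 8 * (1/4)^k"
        by simp
    qed
  qed (use dint in auto)
  then have "AE t in M. convergent (\<lambda>n. u n t)"
  proof eventually_elim
    fix t assume s: "summable (\<lambda>k. 2^k * (norm (u (Suc k) t - u k t))\<^sup>2)"
    have "summable (\<lambda>k. (1/2)^k + 2^k * (norm (u (Suc k) t - u k t))\<^sup>2)"
      by (intro summable_add s summable_geometric) auto
    then have "summable (\<lambda>k. u (Suc k) t - u k t)"
    proof (rule summable_comparison_test')
      fix k
      define y where "y = norm (u (Suc k) t - u k t)"
      \<comment> \<open>Either y is below (1/2)^k, or 2^k * y is at least 1 and y is dominated by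
        the weighted square. Thus summable weighted squares give absolutely summable
        increments.\<close>
      have "y \<le> (1/2)^k + 2^k * y\<^sup>2"
      proof (cases "y \<le> (1/2)^k")
        case False
        then have "1 \<le> 2^k * y" by (simp add: power_divide field_simps)
        then have "1 * y \<le> (2^k * y) * y" by (intro mult_right_mono) (auto simp: y_def)
        then have "y \<le> 2^k * y\<^sup>2" unfolding power2_eq_square by (simp add: ac_simps)
        moreover have "0 \<le> (1/2::real)^k" by simp
        ultimately show ?thesis by linarith
      qed (simp add: add_increasing2)
      then show "norm (u (Suc k) t - u k t) \<le> (1/2)^k + 2^k * (norm (u (Suc k) t - u k t))\<^sup>2"
        by (simp add: y_def)
    qed
    then have "(\<lambda>n. u 0 t + (\<Sum>k<n. u (Suc k) t - u k t)) \<longlonglongrightarrow> u 0 t + (\<Sum>k. u (Suc k) t - u k t)"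
      by (intro tendsto_add tendsto_const summable_LIMSEQ)
    then show "convergent (\<lambda>n. u n t)"
      using sum_lessThan_telescope[of "\<lambda>n. u n t"] by (auto simp: convergent_def)
  qed
  with uK show thesis by (rule that)
qed

section \<open>Duality for concave programs with one affine constraint\<close>

text \<open>Controls enter only through the pairs (C u, J u), so the carrier needs no linear
  structure: mixtures are required to exist at the level of these pairs, with at least the mixed
  payoff. Attainment makes the value a real number at every reachable level. The definitions below
  mirror those of the control problem and are identified with them at the end.\<close>

locale concave_program =
  fixes J C :: "'c \<Rightarrow> real" and U :: "'c set"
  assumes concave_affine: "\<And>u v \<theta>. u \<in> U \<Longrightarrow> v \<in> U \<Longrightarrow> 0 \<le> \<theta> \<Longrightarrow> \<theta> \<le> 1 \<Longrightarrow>
      \<exists>w\<in>U. C w = (1 - \<theta>) * C u + \<theta> * C v \<and> (1 - \<theta>) * J u + \<theta> * J v \<le> J w"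
    and attained: "\<And>u. u \<in> U \<Longrightarrow> \<exists>w\<in>U. C w = C u \<and> (\<forall>v\<in>U. C v = C u \<longrightarrow> J v \<le> J w)"
begin

definition opt_value :: "real \<Rightarrow> ereal" where
  "opt_value B = (SUP u\<in>{u \<in> U. C u = B}. ereal (J u))"

definition supergradients :: "real \<Rightarrow> real set" where
  "supergradients B = {p. \<forall>B'\<in>C ` U. opt_value B' - opt_value B \<le> ereal (p * (B' - B))}"

definition dual :: "real \<Rightarrow> ereal" where
  "dual \<mu> = (SUP u\<in>U. ereal (J u + \<mu> * C u))"

definition dual_minimizers :: "real \<Rightarrow> real set" where
  "dual_minimizers B = {\<mu>. is_arg_min (\<lambda>\<mu>. dual \<mu> - ereal (\<mu> * B)) (\<lambda>_. True) \<mu>}"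

text \<open>The Lagrangian condition to which all three kinds of multipliers are reduced.\<close>

definition maximizes :: "real \<Rightarrow> 'c \<Rightarrow> bool" where
  "maximizes \<mu> w \<longleftrightarrow> w \<in> U \<and> (\<forall>u\<in>U. J u + \<mu> * C u \<le> J w + \<mu> * C w)"

section \<open>Supporting lines of the value function\<close>

lemma convex_range: "convex (C ` U)"
  unfolding convex_alt by (auto, metis concave_affine image_eqI)

text \<open>A convex set of reals is an interval, so two reachable levels on either side of B
  enclose a neighbourhood of B.\<close>

lemma interior_range_iff:
  "B \<in> interior (C ` U) \<longleftrightarrow> (\<exists>u1\<in>U. \<exists>u2\<in>U. C u1 < B \<and> B < C u2)"
proof
  assume "B \<in> interior (C ` U)"
  then obtain e where e: "0 < e" "ball B e \<subseteq> C ` U" by (meson mem_interior)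
  then have "B - e/2 \<in> C ` U" "B + e/2 \<in> C ` U"
    by (auto simp: subset_iff dist_real_def)
  then show "\<exists>u1\<in>U. \<exists>u2\<in>U. C u1 < B \<and> B < C u2"
    using e(1) by (force simp: image_iff)
next
  assume "\<exists>u1\<in>U. \<exists>u2\<in>U. C u1 < B \<and> B < C u2"
  then obtain u1 u2 where u: "u1 \<in> U" "u2 \<in> U" "C u1 < B" "B < C u2" by blast
  have "closed_segment (C u1) (C u2) \<subseteq> C ` U"
    by (rule closed_segment_subset[OF _ _ convex_range]) (use u in auto)
  then have "{C u1<..<C u2} \<subseteq> C ` U"
    using u by (auto simp: closed_segment_eq_real_ivl subset_iff)
  then show "B \<in> interior (C ` U)"
    using u by (intro interiorI[of "{C u1<..<C u2}"]) auto
qed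

lemma value_eqI:
  assumes "w \<in> U" "\<And>v. v \<in> U \<Longrightarrow> C v = C w \<Longrightarrow> J v \<le> J w"
  shows "opt_value (C w) = ereal (J w)"
  unfolding opt_value_def by (rule SUP_eqI) (use assms in auto)

lemma value_attained:
  assumes "B \<in> C ` U"
  obtains w where "w \<in> U" "C w = B" "opt_value B = ereal (J w)"
proof -
  obtain u where u: "u \<in> U" "C u = B" using assms by blast
  then obtain w where w: "w \<in> U" "C w = B" "\<And>v. v \<in> U \<Longrightarrow> C v = B \<Longrightarrow> J v \<le> J w"
    using attained[OF u(1)] by auto
  then show thesis using that value_eqI[OF w(1)] by simp
qed

lemma le_value: "u \<in> U \<Longrightarrow> ereal (J u) \<le> opt_value (C u)"
  unfolding opt_value_def by (rule SUP_upper) auto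

text \<open>Since every reachable level is attained, the inequality between values can be tested on
  payoffs of single controls. The left-hand side does not depend on w, so the condition on the right
  is the same for all optimal controls at level B.\<close>

lemma supergradients_iff_maximizes:
  assumes w: "w \<in> U" "C w = B" "opt_value B = ereal (J w)"
  shows "p \<in> supergradients B \<longleftrightarrow> maximizes (- p) w"
proof
  assume p: "p \<in> supergradients B"
  show "maximizes (- p) w" unfolding maximizes_def
  proof (intro conjI ballI w)
    fix u assume u: "u \<in> U"
    obtain w' where w': "w' \<in> U" "C w' = C u" "opt_value (C u) = ereal (J w')"
      using value_attained[of "C u"] u by blast
    then have "J w' - J w \<le> p * (C u - B)"
      using p u w by (auto simp: supergradients_def)
    moreover have "J u \<le> J w'" using le_value[OF u] w' by simp
    ultimately show "J u + - p * C u \<le> J w + - p * C w" using w by (simp add: algebra_simps)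
  qed
next
  assume m: "maximizes (- p) w"
  show "p \<in> supergradients B" unfolding supergradients_def
  proof (intro CollectI ballI)
    fix B' assume "B' \<in> C ` U"
    then obtain w' where w': "w' \<in> U" "C w' = B'" "opt_value B' = ereal (J w')"
      using value_attained by blast
    then have "J w' + - p * C w' \<le> J w + - p * C w" using m by (auto simp: maximizes_def)
    then show "opt_value B' - opt_value B \<le> ereal (p * (B' - B))"
      using w w' by (simp add: algebra_simps)
  qed
qed

text \<open>The negated value is a finite convex function on the interval of reachable levels, and
  such a function has a supporting line at every interior point. At an end point that line could be
  vertical.\<close>

lemma supergradient_exists:
  assumes B: "B \<in> interior (C ` U)"
  shows "supergradients B \<noteq> {}"
proof -
  define v where "v b = real_of_ereal (opt_value b)" for b
  have v: "opt_value b = ereal (v b)" if "b \<in> C ` U" for b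
    using value_attained[OF that] unfolding v_def by (metis real_of_ereal.simps(1))
  have "convex_on (C ` U) (\<lambda>b. - v b)"
  proof (rule convex_onI[OF _ convex_range])
    fix t b b' :: real assume t: "0 < t" "t < 1" and b: "b \<in> C ` U" "b' \<in> C ` U"
    obtain w where w: "w \<in> U" "C w = b" "v b = J w" using value_attained[OF b(1)] v[OF b(1)] by auto
    obtain w' where w': "w' \<in> U" "C w' = b'" "v b' = J w'" using value_attained[OF b(2)] v[OF b(2)] by auto
    obtain z where z: "z \<in> U" "C z = (1 - t) * C w + t * C w'" "(1 - t) * J w + t * J w' \<le> J z"
      using concave_affine[OF w(1) w'(1), of t] t by auto
    have "ereal (J z) \<le> opt_value (C z)" using z by (intro le_value)
    also have "\<dots> = ereal (v (C z))" by (rule v) (use z(1) in blast)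
    finally show "- v ((1 - t) *\<^sub>R b + t *\<^sub>R b') \<le> (1 - t) * - v b + t * - v b'"
      using z w w' by simp
  qed
  from convex_le_Inf_differential[OF this B]
  obtain q where q: "\<And>y. y \<in> C ` U \<Longrightarrow> - v B + q * (y - B) \<le> - v y" by blast
  have "- q \<in> supergradients B" unfolding supergradients_def
  proof (intro CollectI ballI)
    fix B' assume B': "B' \<in> C ` U"
    have "B \<in> C ` U" using B interior_subset by blast
    then show "opt_value B' - opt_value B \<le> ereal (- q * (B' - B))"
      using q[OF B'] v B' by simp
  qed
  then show ?thesis by blast
qed

text \<open>Weak duality bounds the dual objective below by J w for every multiplier. A
  supergradient at the interior level B shows that this bound is reached, so minimizers are exactly
  the multipliers that reach it, and equality means that w maximizes the Lagrangian.\<close>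

lemma dual_minimizers_iff_maximizes:
  assumes B: "B \<in> interior (C ` U)" and w: "w \<in> U" "C w = B" "opt_value B = ereal (J w)"
  shows "\<mu> \<in> dual_minimizers B \<longleftrightarrow> maximizes \<mu> w"
proof -
  have dual_eq: "dual \<nu> - ereal (\<nu> * B) = ereal (J w)" if "maximizes \<nu> w" for \<nu>
  proof -
    have "dual \<nu> = ereal (J w + \<nu> * C w)" unfolding dual_def
      by (rule SUP_eqI) (use that w in \<open>auto simp: maximizes_def\<close>)
    then show ?thesis using w by simp
  qed
  have dual_ge: "ereal (J w) \<le> dual \<nu> - ereal (\<nu> * B)" for \<nu>
  proof -
    have "ereal (J w + \<nu> * C w) \<le> dual \<nu>" unfolding dual_def using w by (intro SUP_upper) auto
    then show ?thesis using w by (cases "dual \<nu>") auto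
  qed
  obtain p where "p \<in> supergradients B" using supergradient_exists[OF B] by blast
  then have p: "maximizes (- p) w" using supergradients_iff_maximizes[OF w] by blast
  show ?thesis
  proof
    assume "\<mu> \<in> dual_minimizers B"
    then have "dual \<mu> - ereal (\<mu> * B) \<le> ereal (J w)"
      using dual_eq[OF p] by (auto simp: dual_minimizers_def is_arg_min_def not_less dest: spec[of _ "- p"])
    then have d: "dual \<mu> \<le> ereal (J w + \<mu> * B)" by (cases "dual \<mu>") auto
    show "maximizes \<mu> w" unfolding maximizes_def
    proof (intro conjI ballI w)
      fix u assume "u \<in> U"
      then have "ereal (J u + \<mu> * C u) \<le> dual \<mu>" unfolding dual_def by (intro SUP_upper)
      with d have "ereal (J u + \<mu> * C u) \<le> ereal (J w + \<mu> * B)" by (rule order_trans[rotated])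
      then show "J u + \<mu> * C u \<le> J w + \<mu> * C w" using w by simp
    qed
  next
    assume "maximizes \<mu> w"
    then show "\<mu> \<in> dual_minimizers B"
      using dual_eq dual_ge by (simp add: dual_minimizers_def is_arg_min_def not_less)
  qed
qed

text \<open>Subtracting p * b from the value leaves a function with a local maximum at B. Near B all
  levels are reachable, so the value is finite there and \<open>real_of_ereal\<close> loses
  nothing.\<close>

lemma supergradient_eq_derivative:
  assumes B: "B \<in> interior (C ` U)"
    and d: "((\<lambda>b. real_of_ereal (opt_value b)) has_real_derivative d) (at B)"
    and p: "p \<in> supergradients B"
  shows "p = d"
proof -
  define g where "g b = real_of_ereal (opt_value b) - p * b" for b
  have "(g has_real_derivative (d - p)) (at B)" unfolding g_def
    by (auto intro!: derivative_eq_intros d)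
  moreover obtain e where e: "0 < e" "ball B e \<subseteq> C ` U" using B by (meson mem_interior)
  have "g b \<le> g B" if "\<bar>B - b\<bar> < e" for b
  proof -
    have b: "b \<in> C ` U" using that e by (auto simp: subset_iff dist_real_def)
    have "B \<in> C ` U" using B interior_subset by blast
    from value_attained[OF this] obtain w where w: "opt_value B = ereal (J w)" by blast
    from value_attained[OF b] obtain w' where w': "opt_value b = ereal (J w')" by blast
    have "opt_value b - opt_value B \<le> ereal (p * (b - B))"
      using p b unfolding supergradients_def by blast
    then show ?thesis by (simp add: g_def w w' algebra_simps)
  qed
  ultimately have "d - p = 0" using e(1) by (intro DERIV_local_max[of g "d - p" B e]) auto
  then show ?thesis by simp
qed

end

section \<open>Trajectories\<close>

lemma weak_derivativeI:
  assumes "integrable (lebesgue_on {0..T}) v" "\<And>t. t \<in> {0..T} \<Longrightarrow> x t = x 0 + integral {0..t} v"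
  shows "weak_derivative T x v"
  unfolding weak_derivative_def L1_def
proof (intro conjI ballI)
  fix t assume t: "t \<in> {0..T}"
  show "x t = x 0 + (LINT s|lebesgue_on {0..t}. v s)"
    using assms(2)[OF t] unfolding primitive_eq_integral(1)[OF assms(1) t] .
qed (use assms(1) in simp)

lemma weak_derivative_integrable: "weak_derivative T x v \<Longrightarrow> integrable (lebesgue_on {0..T}) v"
  by (simp add: weak_derivative_def L1_def)

text \<open>This allows the right-hand side of a differential equation that holds almost everywhere
  to serve as the derivative itself.\<close>

lemma weak_derivative_cong_AE:
  assumes x: "weak_derivative T x v" and ae: "AE t in lebesgue_on {0..T}. v t = v' t"
  shows "weak_derivative T x v'"
proof (rule weak_derivativeI)
  have v: "integrable (lebesgue_on {0..T}) v" by (rule weak_derivative_integrable[OF x])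
  then have m: "v \<in> borel_measurable (lebesgue_on {0..T})" by simp
  have m': "v' \<in> borel_measurable (lebesgue_on {0..T})"
    by (rule borel_measurable_lebesgue_on_cong_AE[OF _ m ae]) simp
  show v': "integrable (lebesgue_on {0..T}) v'"
    by (rule integrable_cong_AE_imp[OF v m' ae])
  fix t assume t: "t \<in> {0..T}"
  have ind: "(\<lambda>s. indicator {0..t} s *\<^sub>R v s) \<in> borel_measurable (lebesgue_on {0..T})"
    "(\<lambda>s. indicator {0..t} s *\<^sub>R v' s) \<in> borel_measurable (lebesgue_on {0..T})"
    using m m' t by (auto intro!: borel_measurable_scaleR borel_measurable_indicator simp: sets_restrict_space_iff)
  have "integral {0..t} v = integral {0..t} v'"
    unfolding primitive_eq_integral(2)[OF v t] primitive_eq_integral(2)[OF v' t]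
    by (rule integral_cong_AE[OF ind]) (use ae in \<open>eventually_elim, simp\<close>)
  then show "x t = x 0 + integral {0..t} v'" using weak_derivative_eq[OF x t] by metis
qed

lemma weak_derivative_lincomb:
  assumes x: "weak_derivative T x v" and y: "weak_derivative T y w"
  shows "weak_derivative T (\<lambda>t. a *\<^sub>R x t + b *\<^sub>R y t) (\<lambda>t. a *\<^sub>R v t + b *\<^sub>R w t)"
proof (rule weak_derivativeI)
  note iv = weak_derivative_integrable[OF x] and iw = weak_derivative_integrable[OF y]
  show "integrable (lebesgue_on {0..T}) (\<lambda>t. a *\<^sub>R v t + b *\<^sub>R w t)" using iv iw by simp
  fix t assume t: "t \<in> {0..T}"
  have "v integrable_on {0..t}" "w integrable_on {0..t}"
    using integrable_on_lebesgue_on_interval[of T _ 0 t] iv iw t by auto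
  then have "((\<lambda>s. a *\<^sub>R v s + b *\<^sub>R w s) has_integral (a *\<^sub>R integral {0..t} v + b *\<^sub>R integral {0..t} w)) {0..t}"
    by (intro has_integral_add has_integral_cmul integrable_integral)
  then have i: "integral {0..t} (\<lambda>s. a *\<^sub>R v s + b *\<^sub>R w s) = a *\<^sub>R integral {0..t} v + b *\<^sub>R integral {0..t} w"
    by (rule integral_unique)
  show "a *\<^sub>R x t + b *\<^sub>R y t = a *\<^sub>R x 0 + b *\<^sub>R y 0 + integral {0..t} (\<lambda>s. a *\<^sub>R v s + b *\<^sub>R w s)"
    unfolding i by (subst weak_derivative_eq[OF x t], subst weak_derivative_eq[OF y t]) (simp add: algebra_simps)
qed

text \<open>Gronwall's inequality with the L1 norm of the inhomogeneity b as initial bound. The case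
  b = 0 is the uniqueness of trajectories.\<close>

lemma weak_derivative_linear_bound:
  fixes A :: "real \<Rightarrow> real^'n^'n"
  assumes K: "\<And>s x. s \<in> {0..T} \<Longrightarrow> norm (A s *v x) \<le> K * norm x" "0 < K"
    and y: "weak_derivative T y (\<lambda>t. A t *v y t + b t)" "y 0 = 0"
    and b: "integrable (lebesgue_on {0..T}) b"
    and t: "t \<in> {0..T}"
  shows "norm (y t) \<le> 2 * (LINT s|lebesgue_on {0..T}. norm (b s)) * exp (2 * K * T)"
proof -
  define \<beta> where "\<beta> = (LINT s|lebesgue_on {0..T}. norm (b s))"
  have cy: "continuous_on {0..T} y" by (rule continuous_on_weak_derivative[OF y(1)])
  have nb: "integrable (lebesgue_on {0..T}) (\<lambda>s. norm (b s))" using b by simp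
  have \<beta>0: "0 \<le> \<beta>" by (simp add: \<beta>_def)
  have "norm (y t) \<le> 2 * \<beta> * exp (2 * K * t)"
  proof (rule gronwall_exp[OF cy K(2) \<beta>0 _ t])
    fix r assume r: "r \<in> {0..T}"
    have sub: "{0..r} \<subseteq> {0..T}" using r by auto
    have in1: "(\<lambda>s. norm (y s)) integrable_on {0..r}"
      by (intro integrable_continuous_interval continuous_intros continuous_on_subset[OF cy sub])
    have in2: "(\<lambda>s. norm (b s)) integrable_on {0..r}"
      by (rule integrable_on_lebesgue_on_interval[OF nb sub])
    have in3: "(\<lambda>s. A s *v y s + b s) integrable_on {0..r}"
      by (rule integrable_on_lebesgue_on_interval[OF weak_derivative_integrable[OF y(1)] sub])
    have hi: "((\<lambda>s. K * norm (y s) + norm (b s)) has_integral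
        (K * integral {0..r} (\<lambda>s. norm (y s)) + integral {0..r} (\<lambda>s. norm (b s)))) {0..r}"
      by (intro has_integral_add has_integral_mult_right integrable_integral in1 in2)
    have "norm (y r) = norm (integral {0..r} (\<lambda>s. A s *v y s + b s))"
      using weak_derivative_eq[OF y(1) r] y(2) by simp
    also have "\<dots> \<le> integral {0..r} (\<lambda>s. K * norm (y s) + norm (b s))"
    proof (rule integral_norm_bound_integral[OF in3])
      show "(\<lambda>s. K * norm (y s) + norm (b s)) integrable_on {0..r}" using hi by blast
      fix s assume "s \<in> {0..r}"
      then have "norm (A s *v y s) \<le> K * norm (y s)" using K(1) sub by blast
      then show "norm (A s *v y s + b s) \<le> K * norm (y s) + norm (b s)"
        using norm_triangle_ineq[of "A s *v y s" "b s"] by linarith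
    qed
    also have "\<dots> = K * integral {0..r} (\<lambda>s. norm (y s)) + integral {0..r} (\<lambda>s. norm (b s))"
      by (rule integral_unique[OF hi])
    also have "integral {0..r} (\<lambda>s. norm (b s)) = (LINT s|lebesgue_on {0..T}. indicator {0..r} s *\<^sub>R norm (b s))"
      by (rule primitive_eq_integral(2)[OF nb r])
    also have "\<dots> \<le> \<beta>" unfolding \<beta>_def
    proof (rule integral_mono)
      show "integrable (lebesgue_on {0..T}) (\<lambda>s. indicator {0..r} s *\<^sub>R norm (b s))"
      proof (rule Bochner_Integration.integrable_bound[OF nb])
        show "(\<lambda>s. indicator {0..r} s *\<^sub>R norm (b s)) \<in> borel_measurable (lebesgue_on {0..T})"
          using nb r by (auto intro!: borel_measurable_times borel_measurable_indicator simp: sets_restrict_space_iff)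
      qed (auto simp: indicator_def)
    qed (use nb in \<open>auto simp: indicator_def\<close>)
    finally show "norm (y r) \<le> \<beta> + K * integral {0..r} (\<lambda>s. norm (y s))" by simp
  qed
  also have "\<dots> \<le> 2 * \<beta> * exp (2 * K * T)"
    using \<beta>0 K(2) t by (intro mult_left_mono) auto
  finally show ?thesis by (simp add: \<beta>_def)
qed

lemma C1_imp_continuous_on:
  fixes g :: "'a::real_inner \<Rightarrow> real"
  assumes "C1 g"
  shows "continuous_on S g"
proof -
  have "(g has_derivative (\<lambda>h. h \<bullet> gradient g z)) (at z)" for z
    using C1_imp_GDERIV[OF assms, of z] by (simp add: gderiv_def)
  then show ?thesis by (meson continuous_at_imp_continuous_on has_derivative_continuous)
qed

lemma continuous_bounded:
  fixes T :: real and x :: "real \<Rightarrow> 'a::real_normed_vector"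
  assumes "continuous_on {0..T} x"
  obtains r where "\<And>t. t \<in> {0..T} \<Longrightarrow> norm (x t) \<le> r"
proof -
  have "bounded (x ` {0..T})" using compact_imp_bounded[OF compact_continuous_image[OF assms]] by simp
  then show thesis using that unfolding bounded_iff by blast
qed

lemma Linf_integrable: "v \<in> Linf T \<Longrightarrow> integrable (lebesgue_on {0..T}) v"
  unfolding Linf_def by (auto intro: integrable_lebesgue_on_bounded)

section \<open>The linear dynamics: existence, uniqueness and dependence on the control\<close>

locale control_problem_structured =
  fixes P :: "('n::finite, 'm::finite) control_problem"
  assumes structured: "structured_problem P"
begin

abbreviation "T \<equiv> horizon P"
abbreviation "M \<equiv> time_measure P"
abbreviation "f \<equiv> run_payoff P"
abbreviation "\<phi> \<equiv> term_payoff P"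
abbreviation "U \<equiv> control_set P"
abbreviation "F \<equiv> \<lambda>t. case_prod (run_payoff P t)"

lemma T_pos: "0 < T"
  and U_compact: "compact U" and U_convex: "convex U" and U_nonempty: "U \<noteq> {}"
  and state_mat: "bounded_measurable T (state_mat P)"
  and control_mat: "bounded_measurable T (control_mat P)"
  and con_state: "bounded_measurable T (con_state P)"
  and con_control: "bounded_measurable T (con_control P)"
  and con_const: "bounded_measurable T (con_const P)"
  and f_measurable: "(\<lambda>t. f t x u) \<in> borel_measurable M"
  and F_C1: "AE t in M. C1 (F t)" and F_concave: "AE t in M. concave_on UNIV (F t)"
  and \<phi>_C1: "C1 \<phi>" and \<phi>_concave: "concave_on UNIV \<phi>"
  using structured unfolding structured_problem_def by (auto elim: eventually_mono)

lemma data_measurable [measurable]: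
  "state_mat P \<in> borel_measurable M" "control_mat P \<in> borel_measurable M"
  "con_state P \<in> borel_measurable M" "con_control P \<in> borel_measurable M" "con_const P \<in> borel_measurable M"
  using state_mat control_mat con_state con_control con_const by (auto simp: bounded_measurable_def)

sublocale finite_measure M
  by (rule finite_measure_lebesgue_on) simp

lemma F_measurable: "(\<lambda>t. F t z) \<in> borel_measurable M"
  using f_measurable[of "fst z" "snd z"] by (simp add: case_prod_beta)

lemma growth:
  obtains c where "0 < c"
    "\<And>t x u. t \<in> {0..T} \<Longrightarrow> u \<in> U \<Longrightarrow> \<bar>f t x u\<bar> \<le> c * (1 + (norm x)\<^sup>2 + (norm u)\<^sup>2)"
    "\<And>x. \<bar>\<phi> x\<bar> \<le> c * (1 + (norm x)\<^sup>2)"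
  using structured unfolding structured_problem_def by blast

lemma F_continuous: "AE t in M. continuous_on UNIV (F t)"
  using F_C1 by eventually_elim (rule C1_imp_continuous_on)

lemma U_bound: obtains r where "0 < r" "\<And>u. u \<in> U \<Longrightarrow> norm u \<le> r"
  using compact_imp_bounded[OF U_compact] unfolding bounded_pos by blast

lemma admissible_measurable: "u \<in> admissible P \<Longrightarrow> u \<in> borel_measurable M"
  and admissible_AE: "u \<in> admissible P \<Longrightarrow> AE t in M. u t \<in> U"
  by (auto simp: admissible_def Linf_def)

lemma admissibleI:
  assumes "u \<in> borel_measurable M" "AE t in M. u t \<in> U"
  shows "u \<in> admissible P"
proof -
  obtain r where "\<And>u. u \<in> U \<Longrightarrow> norm u \<le> r" using U_bound by blast
  then have "AE t in M. norm (u t) \<le> r" using assms(2) by (auto elim: eventually_mono)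
  then show ?thesis using assms by (auto simp: admissible_def Linf_def)
qed

lemma AE_time: "(\<And>t. t \<in> {0..T} \<Longrightarrow> Q t) \<Longrightarrow> AE t in M. Q t"
  by (rule AE_I2) simp

lemma velocity_Linf:
  assumes u: "u \<in> admissible P" and x: "continuous_on {0..T} x"
  shows "(\<lambda>t. velocity P t (x t) (u t)) \<in> Linf T"
proof -
  obtain KA where KA: "0 < KA" "\<And>t x. t \<in> {0..T} \<Longrightarrow> norm (state_mat P t *v x) \<le> KA * norm x"
    using bounded_measurable_matrix_boundE[OF state_mat] by blast
  obtain KB where KB: "0 < KB" "\<And>t x. t \<in> {0..T} \<Longrightarrow> norm (control_mat P t *v x) \<le> KB * norm x"
    using bounded_measurable_matrix_boundE[OF control_mat] by blast
  obtain r where r: "\<And>t. t \<in> {0..T} \<Longrightarrow> norm (x t) \<le> r" using continuous_bounded[OF x] by blast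
  obtain \<rho> where \<rho>: "0 < \<rho>" "\<And>u. u \<in> U \<Longrightarrow> norm u \<le> \<rho>" using U_bound by blast
  note [measurable] = admissible_measurable[OF u] borel_measurable_lebesgue_on_continuous[OF x]
  have "AE t in M. norm (velocity P t (x t) (u t)) \<le> KA * r + KB * \<rho>"
    using admissible_AE[OF u] AE_space
  proof eventually_elim
    fix t assume t: "u t \<in> U" "t \<in> space M"
    have "norm (state_mat P t *v x t) \<le> KA * r"
      by (rule order_trans[OF KA(2) mult_left_mono[OF r]]) (use KA(1) t in auto)
    moreover have "norm (control_mat P t *v u t) \<le> KB * \<rho>"
      by (rule order_trans[OF KB(2) mult_left_mono[OF \<rho>(2)]]) (use KB(1) t in auto)
    ultimately show "norm (velocity P t (x t) (u t)) \<le> KA * r + KB * \<rho>"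
      unfolding velocity_def using norm_triangle_ineq[of "state_mat P t *v x t" "control_mat P t *v u t"] by linarith
  qed
  moreover have "(\<lambda>t. velocity P t (x t) (u t)) \<in> borel_measurable M"
    unfolding velocity_def by measurable
  ultimately show ?thesis unfolding Linf_def by blast
qed

lemma control_term_integrable:
  assumes u: "u \<in> admissible P"
  shows "integrable M (\<lambda>t. control_mat P t *v u t)"
  using Linf_integrable[OF velocity_Linf[OF u, of "\<lambda>_. 0"]] by (simp add: velocity_def)

text \<open>Derivatives that agree almost everywhere have the same primitives, so the velocity
  itself can be taken as v. Conversely, a continuous x and a control with values in the bounded set
  U give a velocity in \<open>Linf\<close>.\<close>

lemma is_trajectory_iff:
  assumes u: "u \<in> admissible P"
  shows "is_trajectory P u x \<longleftrightarrow> x 0 = init_state P \<and> weak_derivative T x (\<lambda>t. velocity P t (x t) (u t))"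
proof
  assume "is_trajectory P u x"
  then obtain v where v: "x 0 = init_state P" "weak_derivative T x v" "AE t in M. v t = velocity P t (x t) (u t)"
    unfolding is_trajectory_def by blast
  then show "x 0 = init_state P \<and> weak_derivative T x (\<lambda>t. velocity P t (x t) (u t))"
    using weak_derivative_cong_AE[OF v(2,3)] by simp
next
  assume r: "x 0 = init_state P \<and> weak_derivative T x (\<lambda>t. velocity P t (x t) (u t))"
  then have "(\<lambda>t. velocity P t (x t) (u t)) \<in> Linf T"
    by (intro velocity_Linf[OF u] continuous_on_weak_derivative) (rule conjunct2)
  then show "is_trajectory P u x" unfolding is_trajectory_def using r
    by (intro conjI exI[of _ "\<lambda>t. velocity P t (x t) (u t)"]) auto
qed

lemma trajectory_exists:
  assumes u: "u \<in> admissible P"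
  shows "\<exists>x. is_trajectory P u x"
proof -
  note i = control_term_integrable[OF u]
  have ion: "(\<lambda>t. control_mat P t *v u t) integrable_on {0..t}" if "t \<in> {0..T}" for t
    using that by (intro integrable_on_lebesgue_on_interval[OF i]) auto
  \<comment> \<open>The whole contribution of the control goes into the continuous forcing term of
    the Volterra equation.\<close>
  have cg: "continuous_on {0..T} (\<lambda>t. init_state P + integral {0..t} (\<lambda>s. control_mat P s *v u s))"
    using T_pos by (intro continuous_intros indefinite_integral_continuous_1 ion) auto
  obtain y where y: "continuous_on {0..T} y" and yt: "\<And>t. t \<in> {0..T} \<Longrightarrow>
      y t = (init_state P + integral {0..t} (\<lambda>s. control_mat P s *v u s)) + integral {0..t} (\<lambda>s. state_mat P s *v y s)"
    using linear_Volterra_forward[OF less_imp_le[OF T_pos] state_mat cg] by blast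
  have y0: "y 0 = init_state P" using yt[of 0] T_pos by simp
  have iv: "integrable M (\<lambda>t. velocity P t (y t) (u t))" using Linf_integrable[OF velocity_Linf[OF u y]] .
  have "integrable M (\<lambda>t. velocity P t (y t) (u t) - control_mat P t *v u t)" using iv i by simp
  then have iA: "integrable M (\<lambda>t. state_mat P t *v y t)" by (simp add: velocity_def)
  have "weak_derivative T y (\<lambda>t. velocity P t (y t) (u t))"
  proof (rule weak_derivativeI[OF iv])
    fix t assume t: "t \<in> {0..T}"
    have "(\<lambda>t. state_mat P t *v y t) integrable_on {0..t}"
      using t by (intro integrable_on_lebesgue_on_interval[OF iA]) auto
    then show "y t = y 0 + integral {0..t} (\<lambda>t. velocity P t (y t) (u t))"
      unfolding velocity_def y0 yt[OF t]
      by (simp add: Henstock_Kurzweil_Integration.integral_add ion[OF t])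
  qed
  then have "is_trajectory P u y" unfolding is_trajectory_iff[OF u] using y0 by simp
  then show ?thesis by blast
qed

lemma trajectory_0: "u \<in> admissible P \<Longrightarrow> trajectory P u 0 = init_state P"
  and trajectory_weak_derivative: "u \<in> admissible P \<Longrightarrow>
    weak_derivative T (trajectory P u) (\<lambda>t. velocity P t (trajectory P u t) (u t))"
proof -
  assume u: "u \<in> admissible P"
  have "is_trajectory P u (trajectory P u)"
    unfolding trajectory_def by (rule someI_ex[OF trajectory_exists[OF u]])
  then show "trajectory P u 0 = init_state P"
    "weak_derivative T (trajectory P u) (\<lambda>t. velocity P t (trajectory P u t) (u t))"
    unfolding is_trajectory_iff[OF u] by simp_all
qed

lemma trajectory_continuous: "u \<in> admissible P \<Longrightarrow> continuous_on {0..T} (trajectory P u)"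
  by (rule continuous_on_weak_derivative[OF trajectory_weak_derivative])

lemma trajectory_difference:
  assumes u: "u \<in> admissible P" and x: "x 0 = init_state P" "weak_derivative T x (\<lambda>t. velocity P t (x t) (u t))"
    and v: "v \<in> admissible P" and y: "y 0 = init_state P" "weak_derivative T y (\<lambda>t. velocity P t (y t) (v t))"
  shows "weak_derivative T (\<lambda>t. x t - y t) (\<lambda>t. state_mat P t *v (x t - y t) + control_mat P t *v (u t - v t))"
  using weak_derivative_lincomb[OF x(2) y(2), of 1 "- 1"]
  by (simp add: velocity_def algebra_simps matrix_vector_mult_diff_distrib)

lemma trajectory_unique:
  assumes u: "u \<in> admissible P" and x: "x 0 = init_state P" "weak_derivative T x (\<lambda>t. velocity P t (x t) (u t))"
    and t: "t \<in> {0..T}"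
  shows "trajectory P u t = x t"
proof -
  obtain KA where KA: "0 < KA" "\<And>t x. t \<in> {0..T} \<Longrightarrow> norm (state_mat P t *v x) \<le> KA * norm x"
    using bounded_measurable_matrix_boundE[OF state_mat] by blast
  have wd: "weak_derivative T (\<lambda>t. x t - trajectory P u t)
      (\<lambda>t. state_mat P t *v (x t - trajectory P u t) + 0)"
    using trajectory_difference[OF u x u trajectory_0[OF u] trajectory_weak_derivative[OF u]]
    by simp
  have "norm (x t - trajectory P u t) \<le> 2 * (LINT s|M. norm (0 :: real^'n)) * exp (2 * KA * T)"
    by (rule weak_derivative_linear_bound[where A="state_mat P" and b="\<lambda>_. 0", OF KA(2) KA(1) wd])
       (use t x trajectory_0[OF u] in auto)
  then show ?thesis by simp
qed

text \<open>The initial states cancel in the difference of two trajectories. Because the bound uses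
  the L1 distance of the controls and not a supremum, almost everywhere convergence of uniformly
  bounded controls is enough for trajectories to converge.\<close>

lemma trajectory_lipschitz:
  obtains L where "0 \<le> L" "\<And>u v t. u \<in> admissible P \<Longrightarrow> v \<in> admissible P \<Longrightarrow> t \<in> {0..T} \<Longrightarrow>
    norm (trajectory P u t - trajectory P v t) \<le> L * (LINT s|M. norm (u s - v s))"
proof -
  obtain KA where KA: "0 < KA" "\<And>t x. t \<in> {0..T} \<Longrightarrow> norm (state_mat P t *v x) \<le> KA * norm x"
    using bounded_measurable_matrix_boundE[OF state_mat] by blast
  obtain KB where KB: "0 < KB" "\<And>t x. t \<in> {0..T} \<Longrightarrow> norm (control_mat P t *v x) \<le> KB * norm x"
    using bounded_measurable_matrix_boundE[OF control_mat] by blast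
  show thesis
  proof
    show "0 \<le> 2 * KB * exp (2 * KA * T)" using KB by simp
    fix u v t assume u: "u \<in> admissible P" and v: "v \<in> admissible P" and t: "t \<in> {0..T}"
    note wd = trajectory_difference[OF u trajectory_0[OF u] trajectory_weak_derivative[OF u]
        v trajectory_0[OF v] trajectory_weak_derivative[OF v]]
    have ib: "integrable M (\<lambda>s. control_mat P s *v (u s - v s))"
      using control_term_integrable[OF u] control_term_integrable[OF v] by (simp add: matrix_vector_mult_diff_distrib)
    have Linf: "integrable M w" if "w \<in> admissible P" for w
      using that Linf_integrable by (auto simp: admissible_def)
    have "(LINT s|M. norm (control_mat P s *v (u s - v s))) \<le> (LINT s|M. KB * norm (u s - v s))"
      by (rule integral_mono) (use ib KB Linf[OF u] Linf[OF v] in auto)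
    then have "(LINT s|M. norm (control_mat P s *v (u s - v s))) \<le> KB * (LINT s|M. norm (u s - v s))" by simp
    then have "2 * (LINT s|M. norm (control_mat P s *v (u s - v s))) * exp (2 * KA * T)
      \<le> 2 * (KB * (LINT s|M. norm (u s - v s))) * exp (2 * KA * T)"
      by (intro mult_right_mono mult_left_mono) auto
    moreover have "norm (trajectory P u t - trajectory P v t) \<le>
      2 * (LINT s|M. norm (control_mat P s *v (u s - v s))) * exp (2 * KA * T)"
      by (rule weak_derivative_linear_bound[where A="state_mat P", OF KA(2) KA(1) wd])
         (use t u v ib trajectory_0 in auto)
    ultimately have "norm (trajectory P u t - trajectory P v t)
      \<le> 2 * (KB * (LINT s|M. norm (u s - v s))) * exp (2 * KA * T)"
      by (rule order_trans[rotated])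
    also have "\<dots> = 2 * KB * exp (2 * KA * T) * (LINT s|M. norm (u s - v s))" by simp
    finally show "norm (trajectory P u t - trajectory P v t) \<le> 2 * KB * exp (2 * KA * T) * (LINT s|M. norm (u s - v s))" .
  qed
qed

lemma admissible_nonempty: "admissible P \<noteq> {}"
proof -
  obtain u where "u \<in> U" using U_nonempty by blast
  then have "(\<lambda>_. u) \<in> admissible P" by (intro admissibleI) auto
  then show ?thesis by blast
qed

text \<open>Every admissible control is within 2 \<rho> of one reference control almost everywhere,
  so the Lipschitz estimate turns the bound for the reference trajectory into one for all.\<close>

lemma trajectory_bounded:
  obtains R where "0 \<le> R" "\<And>u t. u \<in> admissible P \<Longrightarrow> t \<in> {0..T} \<Longrightarrow> norm (trajectory P u t) \<le> R"
proof -
  obtain w where w: "w \<in> admissible P" using admissible_nonempty by blast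
  obtain r where r: "\<And>t. t \<in> {0..T} \<Longrightarrow> norm (trajectory P w t) \<le> r"
    using continuous_bounded[OF trajectory_continuous[OF w]] by blast
  obtain L where L: "0 \<le> L" "\<And>u v t. u \<in> admissible P \<Longrightarrow> v \<in> admissible P \<Longrightarrow> t \<in> {0..T} \<Longrightarrow>
    norm (trajectory P u t - trajectory P v t) \<le> L * (LINT s|M. norm (u s - v s))"
    using trajectory_lipschitz by blast
  obtain \<rho> where \<rho>: "0 < \<rho>" "\<And>u. u \<in> U \<Longrightarrow> norm u \<le> \<rho>" using U_bound by blast
  show thesis
  proof
    have "0 \<le> r" using order_trans[OF norm_ge_zero r[of 0]] T_pos by simp
    then show "0 \<le> r + L * (LINT s|M. 2 * \<rho>)" using L \<rho> by simp
    fix u t assume u: "u \<in> admissible P" and t: "t \<in> {0..T}"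
    have "integrable M v" if "v \<in> admissible P" for v
      using that Linf_integrable by (auto simp: admissible_def)
    moreover have "AE s in M. norm (u s - w s) \<le> 2 * \<rho>"
      using admissible_AE[OF u] admissible_AE[OF w]
    proof eventually_elim
      fix s assume "u s \<in> U" "w s \<in> U"
      then have "norm (u s) \<le> \<rho>" "norm (w s) \<le> \<rho>" using \<rho> by auto
      then show "norm (u s - w s) \<le> 2 * \<rho>" by norm
    qed
    ultimately have "(LINT s|M. norm (u s - w s)) \<le> (LINT s|M. 2 * \<rho>)"
      using u w by (intro integral_mono_AE) auto
    then have "L * (LINT s|M. norm (u s - w s)) \<le> L * (LINT s|M. 2 * \<rho>)" by (rule mult_left_mono[OF _ L(1)])
    then show "norm (trajectory P u t) \<le> r + L * (LINT s|M. 2 * \<rho>)"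
      using L(2)[OF u w t] r[OF t] norm_triangle_sub[of "trajectory P u t" "trajectory P w t"] by linarith
  qed
qed

lemma admissible_convex:
  assumes u: "u \<in> admissible P" and v: "v \<in> admissible P" and \<theta>: "0 \<le> \<theta>" "\<theta> \<le> 1"
  shows "(\<lambda>t. (1 - \<theta>) *\<^sub>R u t + \<theta> *\<^sub>R v t) \<in> admissible P"
proof (rule admissibleI)
  show "(\<lambda>t. (1 - \<theta>) *\<^sub>R u t + \<theta> *\<^sub>R v t) \<in> borel_measurable M"
    using admissible_measurable[OF u] admissible_measurable[OF v] by measurable
  show "AE t in M. (1 - \<theta>) *\<^sub>R u t + \<theta> *\<^sub>R v t \<in> U"
    using admissible_AE[OF u] admissible_AE[OF v]
    by eventually_elim (use U_convex \<theta> in \<open>auto intro: convexD\<close>)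
qed

text \<open>The convex combination of the two trajectories solves the equation for the combined
  control; it starts at the right point because the weights sum to 1. Uniqueness does the
  rest.\<close>

lemma trajectory_affine:
  assumes u: "u \<in> admissible P" and v: "v \<in> admissible P" and \<theta>: "0 \<le> \<theta>" "\<theta> \<le> 1" and t: "t \<in> {0..T}"
  shows "trajectory P (\<lambda>t. (1 - \<theta>) *\<^sub>R u t + \<theta> *\<^sub>R v t) t = (1 - \<theta>) *\<^sub>R trajectory P u t + \<theta> *\<^sub>R trajectory P v t"
proof (rule trajectory_unique[OF admissible_convex[OF u v \<theta>] _ _ t])
  show "(1 - \<theta>) *\<^sub>R trajectory P u 0 + \<theta> *\<^sub>R trajectory P v 0 = init_state P"
    using u v by (simp add: trajectory_0 algebra_simps)
  show "weak_derivative T (\<lambda>t. (1 - \<theta>) *\<^sub>R trajectory P u t + \<theta> *\<^sub>R trajectory P v t)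
     (\<lambda>t. velocity P t ((1 - \<theta>) *\<^sub>R trajectory P u t + \<theta> *\<^sub>R trajectory P v t) ((1 - \<theta>) *\<^sub>R u t + \<theta> *\<^sub>R v t))"
    using weak_derivative_lincomb[OF trajectory_weak_derivative[OF u] trajectory_weak_derivative[OF v], of "1 - \<theta>" \<theta>]
    by (simp add: velocity_def matrix_vector_right_distrib matrix_vector_mult_scaleR scaleR_add_right add.assoc add.left_commute)
qed

end

section \<open>Existence of optimal controls\<close>

context control_problem_structured
begin

abbreviation "J \<equiv> payoff P"
abbreviation "C \<equiv> constraint P"

section \<open>Integrability, convexity and continuity of payoff and constraint\<close>

lemma payoff_density_measurable:
  assumes "x \<in> borel_measurable M" "u \<in> borel_measurable M"
  shows "(\<lambda>t. f t (x t) (u t)) \<in> borel_measurable M"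
proof -
  have "(\<lambda>t. F t (x t, u t)) \<in> borel_measurable M"
    by (rule borel_measurable_Caratheodory_AE[OF _ F_measurable F_continuous])
       (use assms in \<open>auto intro: borel_measurable_Pair\<close>)
  then show ?thesis by simp
qed

lemma payoff_density_bound:
  obtains k where "0 \<le> k" "\<And>t x u. t \<in> {0..T} \<Longrightarrow> norm x \<le> r \<Longrightarrow> u \<in> U \<Longrightarrow> \<bar>f t x u\<bar> \<le> k"
proof -
  obtain c where c: "0 < c" "\<And>t x u. t \<in> {0..T} \<Longrightarrow> u \<in> U \<Longrightarrow> \<bar>f t x u\<bar> \<le> c * (1 + (norm x)\<^sup>2 + (norm u)\<^sup>2)"
      "\<And>x. \<bar>\<phi> x\<bar> \<le> c * (1 + (norm x)\<^sup>2)"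
    by (rule growth, rule that)
  obtain \<rho> where \<rho>: "0 < \<rho>" "\<And>u. u \<in> U \<Longrightarrow> norm u \<le> \<rho>" by (rule U_bound, rule that)
  show thesis
  proof
    show "0 \<le> c * (1 + r\<^sup>2 + \<rho>\<^sup>2)" using c by (auto intro!: mult_nonneg_nonneg add_nonneg_nonneg)
    fix t u and x :: "real^'n" assume t: "t \<in> {0..T}" and x: "norm x \<le> r" and u: "u \<in> U"
    have "(norm x)\<^sup>2 \<le> r\<^sup>2" "(norm u)\<^sup>2 \<le> \<rho>\<^sup>2" using x \<rho>(2)[OF u] by (auto intro: power_mono)
    then have "c * (1 + (norm x)\<^sup>2 + (norm u)\<^sup>2) \<le> c * (1 + r\<^sup>2 + \<rho>\<^sup>2)"
      using c(1) by (intro mult_left_mono add_mono) auto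
    with c(2)[OF t u, of x] show "\<bar>f t x u\<bar> \<le> c * (1 + r\<^sup>2 + \<rho>\<^sup>2)" by (rule order_trans)
  qed
qed

lemma payoff_density_integrable:
  assumes x: "x \<in> borel_measurable M" "\<And>t. t \<in> {0..T} \<Longrightarrow> norm (x t) \<le> r" and u: "u \<in> admissible P"
  shows "integrable M (\<lambda>t. f t (x t) (u t))"
proof -
  obtain k where "0 \<le> k" and k: "\<And>t x u. t \<in> {0..T} \<Longrightarrow> norm x \<le> r \<Longrightarrow> u \<in> U \<Longrightarrow> \<bar>f t x u\<bar> \<le> k"
    by (rule payoff_density_bound[of r], rule that)
  show ?thesis
  proof (rule integrable_lebesgue_on_bounded)
    show "(\<lambda>t. f t (x t) (u t)) \<in> borel_measurable M"
      by (rule payoff_density_measurable[OF x(1) admissible_measurable[OF u]])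
    show "AE t in M. norm (f t (x t) (u t)) \<le> k"
      using admissible_AE[OF u] AE_space by eventually_elim (use k x in auto)
  qed
qed

lemma trajectory_measurable: "u \<in> admissible P \<Longrightarrow> trajectory P u \<in> borel_measurable M"
  by (intro borel_measurable_lebesgue_on_continuous trajectory_continuous)

lemma trajectory_payoff_integrable:
  assumes u: "u \<in> admissible P"
  shows "integrable M (\<lambda>t. f t (trajectory P u t) (u t))"
proof -
  obtain R where "0 \<le> R" and R: "\<And>u t. u \<in> admissible P \<Longrightarrow> t \<in> {0..T} \<Longrightarrow> norm (trajectory P u t) \<le> R"
    by (rule trajectory_bounded, rule that)
  from R[OF u] show ?thesis by (rule payoff_density_integrable[OF trajectory_measurable[OF u] _ u])
qed

lemma con_density_measurable:
  assumes [measurable]: "x \<in> borel_measurable M" "u \<in> borel_measurable M"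
  shows "(\<lambda>t. con_density P t (x t) (u t)) \<in> borel_measurable M"
  unfolding con_density_def by measurable

lemma con_density_bound:
  obtains k where "0 \<le> k" "\<And>t x u. t \<in> {0..T} \<Longrightarrow> norm x \<le> r \<Longrightarrow> u \<in> U \<Longrightarrow> \<bar>con_density P t x u\<bar> \<le> k"
proof -
  obtain \<rho> where \<rho>: "0 < \<rho>" "\<And>u. u \<in> U \<Longrightarrow> norm u \<le> \<rho>" by (rule U_bound, rule that)
  obtain a where a: "0 < a" "\<And>t. t \<in> {0..T} \<Longrightarrow> norm (con_state P t) \<le> a"
    using con_state unfolding bounded_measurable_def bounded_pos by blast
  obtain b where b: "0 < b" "\<And>t. t \<in> {0..T} \<Longrightarrow> norm (con_control P t) \<le> b"
    using con_control unfolding bounded_measurable_def bounded_pos by blast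
  obtain c where c: "0 < c" "\<And>t. t \<in> {0..T} \<Longrightarrow> norm (con_const P t) \<le> c"
    using con_const unfolding bounded_measurable_def bounded_pos by blast
  show thesis
  proof
    show "0 \<le> a * \<bar>r\<bar> + b * \<rho> + c" using a b c \<rho> by simp
    fix t u and x :: "real^'n" assume t: "t \<in> {0..T}" and x: "norm x \<le> r" and u: "u \<in> U"
    have "\<bar>con_state P t \<bullet> x\<bar> \<le> a * \<bar>r\<bar>"
      by (rule order_trans[OF Cauchy_Schwarz_ineq2 mult_mono[OF a(2)[OF t]]]) (use a x in auto)
    moreover have "\<bar>con_control P t \<bullet> u\<bar> \<le> b * \<rho>"
      by (rule order_trans[OF Cauchy_Schwarz_ineq2 mult_mono[OF b(2)[OF t] \<rho>(2)[OF u]]]) (use b in auto)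
    ultimately show "\<bar>con_density P t x u\<bar> \<le> a * \<bar>r\<bar> + b * \<rho> + c"
      using c(2)[OF t] unfolding con_density_def by simp
  qed
qed

lemma trajectory_con_integrable:
  assumes u: "u \<in> admissible P"
  shows "integrable M (\<lambda>t. con_density P t (trajectory P u t) (u t))"
proof -
  obtain R where "0 \<le> R" and R': "\<And>u t. u \<in> admissible P \<Longrightarrow> t \<in> {0..T} \<Longrightarrow> norm (trajectory P u t) \<le> R"
    by (rule trajectory_bounded, rule that)
  note R = R'[OF u]
  obtain k where "0 \<le> k" and k: "\<And>t x u. t \<in> {0..T} \<Longrightarrow> norm x \<le> R \<Longrightarrow> u \<in> U \<Longrightarrow> \<bar>con_density P t x u\<bar> \<le> k"
    by (rule con_density_bound[of R], rule that)
  show ?thesis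
  proof (rule integrable_lebesgue_on_bounded)
    show "(\<lambda>t. con_density P t (trajectory P u t) (u t)) \<in> borel_measurable M"
      by (intro con_density_measurable trajectory_measurable admissible_measurable u)
    show "AE t in M. norm (con_density P t (trajectory P u t) (u t)) \<le> k"
      using admissible_AE[OF u] AE_space by eventually_elim (use k R in auto)
  qed
qed

lemma payoff_bounded:
  obtains k where "\<And>u. u \<in> admissible P \<Longrightarrow> J u \<le> k"
proof -
  obtain R where R: "0 \<le> R" "\<And>u t. u \<in> admissible P \<Longrightarrow> t \<in> {0..T} \<Longrightarrow> norm (trajectory P u t) \<le> R"
    by (rule trajectory_bounded, rule that)
  obtain k where k: "0 \<le> k" "\<And>t x u. t \<in> {0..T} \<Longrightarrow> norm x \<le> R \<Longrightarrow> u \<in> U \<Longrightarrow> \<bar>f t x u\<bar> \<le> k"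
    by (rule payoff_density_bound[of R], rule that)
  obtain c where c: "0 < c" "\<And>t x u. t \<in> {0..T} \<Longrightarrow> u \<in> U \<Longrightarrow> \<bar>f t x u\<bar> \<le> c * (1 + (norm x)\<^sup>2 + (norm u)\<^sup>2)"
      "\<And>x. \<bar>\<phi> x\<bar> \<le> c * (1 + (norm x)\<^sup>2)"
    by (rule growth, rule that)
  show thesis
  proof
    fix u assume u: "u \<in> admissible P"
    have "(LINT t|M. f t (trajectory P u t) (u t)) \<le> (LINT t|M. k)"
    proof (rule integral_mono_AE[OF trajectory_payoff_integrable[OF u]])
      show "AE t in M. f t (trajectory P u t) (u t) \<le> k"
        using admissible_AE[OF u] AE_space
      proof eventually_elim
        fix t assume "u t \<in> U" "t \<in> space M"
        then show "f t (trajectory P u t) (u t) \<le> k"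
          using k(2)[OF _ R(2)[OF u], of t t "u t"] by auto
      qed
    qed simp
    moreover have "\<phi> (trajectory P u T) \<le> c * (1 + R\<^sup>2)"
    proof -
      have "(norm (trajectory P u T))\<^sup>2 \<le> R\<^sup>2" using R(2)[OF u, of T] T_pos by (auto intro: power_mono)
      then have "c * (1 + (norm (trajectory P u T))\<^sup>2) \<le> c * (1 + R\<^sup>2)" using c(1) by simp
      then show ?thesis using c(3)[of "trajectory P u T"] by linarith
    qed
    ultimately show "J u \<le> (LINT t|M. k) + c * (1 + R\<^sup>2)" unfolding payoff_def by linarith
  qed
qed

lemma constraint_affine:
  assumes u: "u \<in> admissible P" and v: "v \<in> admissible P" and \<theta>: "0 \<le> \<theta>" "\<theta> \<le> 1"
  shows "C (\<lambda>t. (1 - \<theta>) *\<^sub>R u t + \<theta> *\<^sub>R v t) = (1 - \<theta>) * C u + \<theta> * C v"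
proof -
  have "C (\<lambda>t. (1 - \<theta>) *\<^sub>R u t + \<theta> *\<^sub>R v t) =
    (LINT t|M. (1 - \<theta>) * con_density P t (trajectory P u t) (u t) + \<theta> * con_density P t (trajectory P v t) (v t))"
    unfolding constraint_def
  proof (rule Bochner_Integration.integral_cong)
    fix t assume "t \<in> space M"
    then have t: "t \<in> {0..T}" by simp
    show "con_density P t (trajectory P (\<lambda>t. (1 - \<theta>) *\<^sub>R u t + \<theta> *\<^sub>R v t) t) ((1 - \<theta>) *\<^sub>R u t + \<theta> *\<^sub>R v t) =
      (1 - \<theta>) * con_density P t (trajectory P u t) (u t) + \<theta> * con_density P t (trajectory P v t) (v t)"
      unfolding trajectory_affine[OF u v \<theta> t] con_density_def by (simp add: inner_add_right algebra_simps)
  qed simp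
  also have "\<dots> = (1 - \<theta>) * C u + \<theta> * C v"
    using trajectory_con_integrable[OF u] trajectory_con_integrable[OF v] by (simp add: constraint_def)
  finally show ?thesis .
qed

lemma payoff_concave:
  assumes u: "u \<in> admissible P" and v: "v \<in> admissible P" and \<theta>: "0 \<le> \<theta>" "\<theta> \<le> 1"
  shows "(1 - \<theta>) * J u + \<theta> * J v \<le> J (\<lambda>t. (1 - \<theta>) *\<^sub>R u t + \<theta> *\<^sub>R v t)"
proof -
  define w where "w t = (1 - \<theta>) *\<^sub>R u t + \<theta> *\<^sub>R v t" for t
  have w: "w \<in> admissible P" using admissible_convex[OF u v \<theta>] by (simp add: w_def[abs_def])
  have xw: "trajectory P w t = (1 - \<theta>) *\<^sub>R trajectory P u t + \<theta> *\<^sub>R trajectory P v t" if "t \<in> {0..T}" for t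
    using trajectory_affine[OF u v \<theta> that] by (simp add: w_def[abs_def])
  have "(1 - \<theta>) * \<phi> (trajectory P u T) + \<theta> * \<phi> (trajectory P v T) \<le> \<phi> (trajectory P w T)"
    using \<phi>_concave \<theta> T_pos by (subst xw) (auto simp: concave_on_iff)
  moreover have "(1 - \<theta>) * (LINT t|M. f t (trajectory P u t) (u t)) + \<theta> * (LINT t|M. f t (trajectory P v t) (v t))
    = (LINT t|M. (1 - \<theta>) * f t (trajectory P u t) (u t) + \<theta> * f t (trajectory P v t) (v t))"
    using trajectory_payoff_integrable[OF u] trajectory_payoff_integrable[OF v] by simp
  moreover have "\<dots> \<le> (LINT t|M. f t (trajectory P w t) (w t))"
  proof (rule integral_mono_AE)
    show "AE t in M. (1 - \<theta>) * f t (trajectory P u t) (u t) + \<theta> * f t (trajectory P v t) (v t)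
        \<le> f t (trajectory P w t) (w t)"
      using F_concave AE_space
    proof eventually_elim
      fix t assume c: "concave_on UNIV (F t)" and t: "t \<in> space M"
      have "(1 - \<theta>) * F t (trajectory P u t, u t) + \<theta> * F t (trajectory P v t, v t) \<le>
        F t ((1 - \<theta>) *\<^sub>R (trajectory P u t, u t) + \<theta> *\<^sub>R (trajectory P v t, v t))"
        using c \<theta> unfolding concave_on_iff by simp
      then show "(1 - \<theta>) * f t (trajectory P u t) (u t) + \<theta> * f t (trajectory P v t) (v t)
        \<le> f t (trajectory P w t) (w t)"
        using t by (simp add: xw w_def)
    qed
  qed (use trajectory_payoff_integrable u v w in auto)
  ultimately have "(1 - \<theta>) * J u + \<theta> * J v \<le> J w"
    unfolding payoff_def distrib_left by linarith
  then show ?thesis by (simp add: w_def[abs_def])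
qed

text \<open>Controls take values in a bounded set, so their almost everywhere convergence is also L1
  convergence and the trajectories converge at every time. Continuity of the integrands and the
  uniform bounds then allow dominated convergence.\<close>

lemma payoff_constraint_LIMSEQ:
  assumes u: "\<And>n. u n \<in> admissible P" and w: "w \<in> admissible P"
    and lim: "AE t in M. (\<lambda>n. u n t) \<longlonglongrightarrow> w t"
  shows "(\<lambda>n. J (u n)) \<longlonglongrightarrow> J w" "(\<lambda>n. C (u n)) \<longlonglongrightarrow> C w"
proof -
  obtain \<rho> where \<rho>: "0 < \<rho>" "\<And>u. u \<in> U \<Longrightarrow> norm u \<le> \<rho>" by (rule U_bound, rule that)
  obtain R where R: "0 \<le> R" "\<And>u t. u \<in> admissible P \<Longrightarrow> t \<in> {0..T} \<Longrightarrow> norm (trajectory P u t) \<le> R"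
    by (rule trajectory_bounded, rule that)
  obtain L where L: "0 \<le> L" "\<And>u v t. u \<in> admissible P \<Longrightarrow> v \<in> admissible P \<Longrightarrow> t \<in> {0..T} \<Longrightarrow>
    norm (trajectory P u t - trajectory P v t) \<le> L * (LINT s|M. norm (u s - v s))"
    by (rule trajectory_lipschitz, rule that)
  note [measurable] = admissible_measurable[OF u] admissible_measurable[OF w]
  have "(\<lambda>n. LINT s|M. norm (u n s - w s)) \<longlonglongrightarrow> (LINT s|M. 0)"
  proof (rule integral_dominated_convergence[where w="\<lambda>_. 2 * \<rho>"])
    show "AE s in M. (\<lambda>n. norm (u n s - w s)) \<longlonglongrightarrow> 0"
      using lim by eventually_elim (simp add: LIM_zero_iff tendsto_norm_zero_iff)
    show "AE s in M. norm (norm (u n s - w s)) \<le> 2 * \<rho>" for n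
      using admissible_AE[OF u[of n]] admissible_AE[OF w]
    proof eventually_elim
      fix s assume "u n s \<in> U" "w s \<in> U"
      then have "norm (u n s) \<le> \<rho>" "norm (w s) \<le> \<rho>" using \<rho> by auto
      then show "norm (norm (u n s - w s)) \<le> 2 * \<rho>"
        using norm_triangle_ineq4[of "u n s" "w s"] by simp
    qed
  qed auto
  then have l0: "(\<lambda>n. L * (LINT s|M. norm (u n s - w s))) \<longlonglongrightarrow> 0"
    by (intro tendsto_mult_right_zero) simp
  have x: "(\<lambda>n. trajectory P (u n) t) \<longlonglongrightarrow> trajectory P w t" if "t \<in> {0..T}" for t
  proof -
    have "(\<lambda>n. trajectory P (u n) t - trajectory P w t) \<longlonglongrightarrow> 0"
      by (rule Lim_null_comparison[OF _ l0]) (use L(2)[OF u w that] in auto)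
    then show ?thesis by (simp add: LIM_zero_iff)
  qed
  obtain k where "0 \<le> k" and k: "\<And>t x u. t \<in> {0..T} \<Longrightarrow> norm x \<le> R \<Longrightarrow> u \<in> U \<Longrightarrow> \<bar>f t x u\<bar> \<le> k"
    by (rule payoff_density_bound[of R], rule that)
  have "(\<lambda>n. LINT t|M. f t (trajectory P (u n) t) (u n t)) \<longlonglongrightarrow> (LINT t|M. f t (trajectory P w t) (w t))"
  proof (rule integral_dominated_convergence[where w="\<lambda>_. k"])
    show "AE t in M. (\<lambda>n. f t (trajectory P (u n) t) (u n t)) \<longlonglongrightarrow> f t (trajectory P w t) (w t)"
      using lim F_continuous AE_space
    proof eventually_elim
      fix t assume lt: "(\<lambda>n. u n t) \<longlonglongrightarrow> w t" and c: "continuous_on UNIV (F t)" and t: "t \<in> space M"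
      have "(\<lambda>n. (trajectory P (u n) t, u n t)) \<longlonglongrightarrow> (trajectory P w t, w t)"
        using x[of t] lt t by (intro tendsto_Pair) auto
      from continuous_on_tendsto_compose[OF c this]
      show "(\<lambda>n. f t (trajectory P (u n) t) (u n t)) \<longlonglongrightarrow> f t (trajectory P w t) (w t)" by simp
    qed
    show "AE t in M. norm (f t (trajectory P (u n) t) (u n t)) \<le> k" for n
      using admissible_AE[OF u[of n]] AE_space
    proof eventually_elim
      fix t assume "u n t \<in> U" "t \<in> space M"
      then show "norm (f t (trajectory P (u n) t) (u n t)) \<le> k"
        using k[OF _ R(2)[OF u], of t t "u n t"] by auto
    qed
  qed (use payoff_density_measurable trajectory_measurable admissible_measurable u w in auto)
  moreover have "(\<lambda>n. \<phi> (trajectory P (u n) T)) \<longlonglongrightarrow> \<phi> (trajectory P w T)"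
    by (rule continuous_on_tendsto_compose[OF C1_imp_continuous_on[OF \<phi>_C1, of UNIV] x]) (use T_pos in auto)
  ultimately show "(\<lambda>n. J (u n)) \<longlonglongrightarrow> J w" unfolding payoff_def by (rule tendsto_add)
  obtain k' where "0 \<le> k'" and k': "\<And>t x u. t \<in> {0..T} \<Longrightarrow> norm x \<le> R \<Longrightarrow> u \<in> U \<Longrightarrow> \<bar>con_density P t x u\<bar> \<le> k'"
    by (rule con_density_bound[of R], rule that)
  show "(\<lambda>n. C (u n)) \<longlonglongrightarrow> C w" unfolding constraint_def
  proof (rule integral_dominated_convergence[where w="\<lambda>_. k'"])
    show "AE t in M. (\<lambda>n. con_density P t (trajectory P (u n) t) (u n t)) \<longlonglongrightarrow> con_density P t (trajectory P w t) (w t)"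
      using lim AE_space by eventually_elim (auto simp: con_density_def intro!: tendsto_intros x)
    show "AE t in M. norm (con_density P t (trajectory P (u n) t) (u n t)) \<le> k'" for n
      using admissible_AE[OF u[of n]] AE_space
    proof eventually_elim
      fix t assume "u n t \<in> U" "t \<in> space M"
      then show "norm (con_density P t (trajectory P (u n) t) (u n t)) \<le> k'"
        using k'[OF _ R(2)[OF u], of t t "u n t"] by auto
    qed
  qed (use con_density_measurable trajectory_measurable admissible_measurable u w in auto)
qed

lemma optimal_control_exists:
  assumes u0: "u0 \<in> admissible P"
  shows "\<exists>w\<in>admissible P. C w = C u0 \<and> (\<forall>v\<in>admissible P. C v = C u0 \<longrightarrow> J v \<le> J w)"
proof -
  define S where "S = {v \<in> admissible P. C v = C u0}"
  define s where "s = Sup (J ` S)"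
  obtain k where k: "\<And>u. u \<in> admissible P \<Longrightarrow> J u \<le> k" by (rule payoff_bounded, rule that)
  have bdd: "bdd_above (J ` S)" using k by (intro bdd_aboveI[of _ k]) (auto simp: S_def)
  have le_s: "J v \<le> s" if "v \<in> S" for v unfolding s_def using bdd that by (intro cSup_upper) auto
  \<comment> \<open>The lower bound by the minimum is the part of concavity that makes superlevel
    sets of the payoff closed under midpoints.\<close>
  have S_mid: "(\<lambda>t. (1/2) *\<^sub>R (u t + v t)) \<in> S \<and> min (J u) (J v) \<le> J (\<lambda>t. (1/2) *\<^sub>R (u t + v t))"
    if "u \<in> S" "v \<in> S" for u v
  proof -
    have e: "(\<lambda>t. (1/2) *\<^sub>R (u t + v t)) = (\<lambda>t. (1 - 1/2) *\<^sub>R u t + (1/2) *\<^sub>R v t)"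
      by (simp add: scaleR_add_right)
    have "u \<in> admissible P" "v \<in> admissible P" using that by (auto simp: S_def)
    note l = admissible_convex[OF this, of "1/2"] constraint_affine[OF this, of "1/2"] payoff_concave[OF this, of "1/2"]
    show ?thesis unfolding e using l that by (auto simp: S_def min_def)
  qed
  define K where "K n = {v \<in> S. s - 1 / real (Suc n) \<le> J v}" for n
  obtain \<rho> where \<rho>: "0 < \<rho>" "\<And>u. u \<in> U \<Longrightarrow> norm u \<le> \<rho>" by (rule U_bound, rule that)
  obtain u where u: "\<And>n. u n \<in> K n" "AE t in M. convergent (\<lambda>n. u n t)"
  proof (rule nested_midpoint_convex_AE_convergent[where M=M and K=K and R=\<rho>])
    show "finite_measure M" by (rule finite_measure_axioms)
    show "K n \<noteq> {}" for n
    proof -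
      have "J ` S \<noteq> {}" using u0 by (auto simp: S_def)
      then have "\<exists>x\<in>J ` S. s - 1 / real (Suc n) < x"
        unfolding s_def using bdd by (subst less_cSup_iff[symmetric]) auto
      then show ?thesis by (force simp: K_def)
    qed
    show "K n \<subseteq> K m" if "m \<le> n" for m n
    proof -
      have "1 / real (Suc n) \<le> 1 / real (Suc m)" using that by (simp add: frac_le)
      then show ?thesis by (auto simp: K_def)
    qed
    show "v \<in> borel_measurable M" if "v \<in> K n" for n v
      using that admissible_measurable by (auto simp: K_def S_def)
    show "AE t in M. norm (v t) \<le> \<rho>" if "v \<in> K n" for n v
      using admissible_AE[of v] that \<rho> by (auto simp: K_def S_def elim: eventually_mono)
    show "(\<lambda>t. (1 / 2) *\<^sub>R (v t + v' t)) \<in> K n" if "v \<in> K n" "v' \<in> K n" for n v v'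
      using S_mid[of v v'] that by (auto simp: K_def)
  qed blast
  have ua: "u n \<in> admissible P" and Cu: "C (u n) = C u0" and Ju: "s - 1 / real (Suc n) \<le> J (u n)" for n
    using u(1)[of n] by (auto simp: K_def S_def)
  \<comment> \<open>Where the sequence diverges \<open>lim\<close> has an unspecified value; this
    affects only a null set of times.\<close>
  define w where "w t = lim (\<lambda>n. u n t)" for t
  have lim: "AE t in M. (\<lambda>n. u n t) \<longlonglongrightarrow> w t"
    using u(2) by eventually_elim (simp add: w_def convergent_LIMSEQ_iff)
  have w: "w \<in> admissible P"
  proof (rule admissibleI)
    show "w \<in> borel_measurable M"
      unfolding w_def[abs_def] by (rule borel_measurable_lim_metric) (rule admissible_measurable[OF ua])
    have "AE t in M. \<forall>n. u n t \<in> U" using admissible_AE[OF ua] by (simp add: AE_all_countable)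
    with lim show "AE t in M. w t \<in> U"
    proof eventually_elim
      fix t assume l: "(\<lambda>n. u n t) \<longlonglongrightarrow> w t" and m: "\<forall>n. u n t \<in> U"
      show "w t \<in> U" by (rule closed_sequentially[OF compact_imp_closed[OF U_compact] _ l]) (use m in simp)
    qed
  qed
  have "C w = C u0"
    using payoff_constraint_LIMSEQ(2)[OF ua w lim] by (simp add: Cu LIMSEQ_const_iff)
  moreover have "s \<le> J w"
  proof (rule LIMSEQ_le[OF _ payoff_constraint_LIMSEQ(1)[OF ua w lim]])
    show "(\<lambda>n. s - 1 / real (Suc n)) \<longlonglongrightarrow> s"
      using tendsto_diff[OF tendsto_const[of s] LIMSEQ_inverse_real_of_nat] by (simp add: inverse_eq_divide)
  qed (use Ju in auto)
  ultimately show ?thesis using w le_s by (intro bexI[of _ w]) (force simp: S_def)+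
qed

sublocale concave_program "payoff P" "constraint P" "admissible P"
proof
  fix u v \<theta> assume "u \<in> admissible P" "v \<in> admissible P" "0 \<le> \<theta>" "\<theta> \<le> (1::real)"
  then show "\<exists>w\<in>admissible P. C w = (1 - \<theta>) * C u + \<theta> * C v \<and> (1 - \<theta>) * J u + \<theta> * J v \<le> J w"
    using admissible_convex constraint_affine payoff_concave by (intro bexI[of _ "\<lambda>t. (1 - \<theta>) *\<^sub>R u t + \<theta> *\<^sub>R v t"]) auto
qed (rule optimal_control_exists)

end

section \<open>Pontryagin's conditions\<close>

text \<open>Each coordinate of the gradient is almost everywhere a limit of difference quotients,
  and these are measurable as Caratheodory compositions.\<close>

lemma borel_measurable_gradient_Caratheodory:
  fixes f :: "'t::euclidean_space \<Rightarrow> 'a::euclidean_space \<Rightarrow> real"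
  assumes S: "S \<in> sets lebesgue"
    and f: "\<And>z. (\<lambda>t. f t z) \<in> borel_measurable (lebesgue_on S)"
    and cont: "AE t in lebesgue_on S. continuous_on UNIV (f t)"
    and z: "z \<in> borel_measurable (lebesgue_on S)"
    and D: "AE t in lebesgue_on S. GDERIV (f t) (z t) :> D t"
  shows "D \<in> borel_measurable (lebesgue_on S)"
proof (rule borel_measurable_euclidean_space[THEN iffD2], rule ballI)
  fix i :: 'a assume "i \<in> Basis"
  define q where "q n t = (f t (z t + (1 / Suc n) *\<^sub>R i) - f t (z t)) * Suc n" for n t
  have "(\<lambda>t. f t (z t + (1 / Suc n) *\<^sub>R i)) \<in> borel_measurable (lebesgue_on S)" for n
    by (rule borel_measurable_Caratheodory_AE[OF S f cont]) (use z in measurable)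
  moreover have "(\<lambda>t. f t (z t)) \<in> borel_measurable (lebesgue_on S)"
    by (rule borel_measurable_Caratheodory_AE[OF S f cont z])
  ultimately have "q n \<in> borel_measurable (lebesgue_on S)" for n
    unfolding q_def[abs_def] by measurable
  then have m: "(\<lambda>t. lim (\<lambda>n. q n t)) \<in> borel_measurable (lebesgue_on S)"
    by (rule borel_measurable_lim_metric)
  show "(\<lambda>t. D t \<bullet> i) \<in> borel_measurable (lebesgue_on S)"
  proof (rule borel_measurable_lebesgue_on_cong_AE[OF S m])
    show "AE t in lebesgue_on S. lim (\<lambda>n. q n t) = D t \<bullet> i"
      using D
    proof eventually_elim
      fix t assume "GDERIV (f t) (z t) :> D t"
      from GDERIV_imp_LIMSEQ[OF this, of i] show "lim (\<lambda>n. q n t) = D t \<bullet> i"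
        unfolding q_def inner_commute[of "D t"] by (rule limI)
    qed
  qed
qed

lemma GDERIV_fst:
  fixes g :: "'a::real_inner \<times> 'b::real_inner \<Rightarrow> real"
  assumes "GDERIV g (x, u) :> D"
  shows "GDERIV (\<lambda>x. g (x, u)) x :> fst D"
proof -
  have "((\<lambda>x. g (x, u)) has_derivative (\<lambda>h. (h, 0) \<bullet> D)) (at x)"
    by (rule has_derivative_compose[where f="\<lambda>x. (x, u)" and g=g and g'="\<lambda>h. h \<bullet> D"])
       (use assms in \<open>auto intro!: derivative_eq_intros simp: gderiv_def\<close>)
  then show ?thesis by (simp add: gderiv_def inner_prod_def)
qed

lemma inner_sgn_self: "sgn y \<bullet> y = norm y" for y :: "'a::real_inner"
  by (cases "norm y = 0") (simp_all add: sgn_div_norm dot_square_norm power2_eq_square del: norm_eq_zero)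

lemma inner_matrix_vector_transpose: "l \<bullet> (A *v x) = (transpose A *v l) \<bullet> (x :: real^'n)"
  by (simp add: dot_lmul_matrix)

lemma linear_transpose: "linear (transpose :: real^'n^'m \<Rightarrow> real^'m^'n)"
  by (rule linearI) (simp_all add: transpose_def vec_eq_iff)

lemma borel_measurable_transpose [measurable (raw)]:
  fixes A :: "'t \<Rightarrow> real^'n^'m"
  assumes "A \<in> borel_measurable M"
  shows "(\<lambda>t. transpose (A t)) \<in> borel_measurable M"
  using assms
  by (rule measurable_compose)
     (intro borel_measurable_continuous_onI linear_continuous_on linear_transpose[THEN linear_conv_bounded_linear[THEN iffD1]])

lemma bounded_measurable_transpose:
  fixes A :: "real \<Rightarrow> real^'n^'m"
  assumes "bounded_measurable T A"
  shows "bounded_measurable T (\<lambda>t. transpose (A t))"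
proof -
  have "bounded (A ` {0..T})" using assms by (simp add: bounded_measurable_def)
  then have "bounded (transpose ` (A ` {0..T}))"
    by (rule bounded_linear_image) (rule linear_transpose[THEN linear_conv_bounded_linear[THEN iffD1]])
  then show ?thesis using assms by (auto simp: bounded_measurable_def image_image)
qed

section \<open>Hamiltonian, adjoint state and duality identity\<close>

context control_problem_structured
begin

text \<open>The classical switching function: the coefficient of the control in the Hamiltonian
  apart from the running payoff.\<close>

definition switching :: "real \<Rightarrow> real^'n \<Rightarrow> real \<Rightarrow> real^'m" where
  "switching t l \<mu> = transpose (control_mat P t) *v l + \<mu> *\<^sub>R con_control P t"

text \<open>Transposed matrices act on the adjoint state, so that beyond the running payoff only
  separate affine terms in state and control remain. Its state gradient and maximum condition can be
  read off from this form.\<close>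

lemma hamiltonian_eq:
  "hamiltonian P t x v l \<mu> = F t (x, v) + switching t l \<mu> \<bullet> v
    + ((transpose (state_mat P t) *v l + \<mu> *\<^sub>R con_state P t) \<bullet> x + \<mu> * con_const P t)"
  unfolding hamiltonian_def velocity_def con_density_def switching_def inner_add_right inner_matrix_vector_transpose
  by (simp add: inner_add_left algebra_simps)

lemma gradient_hamiltonian:
  assumes "GDERIV (F t) (x, u) :> D"
  shows "gradient (\<lambda>x. hamiltonian P t x u l \<mu>) x =
    fst D + (transpose (state_mat P t) *v l + \<mu> *\<^sub>R con_state P t)"
proof (rule GDERIV_gradient)
  have lin: "GDERIV (\<lambda>x. y \<bullet> x + r) x :> y" for y :: "real^'n" and r
    unfolding gderiv_def by (auto intro!: derivative_eq_intros simp: inner_commute)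
  have "GDERIV (\<lambda>x. F t (x, u) + ((transpose (state_mat P t) *v l + \<mu> *\<^sub>R con_state P t) \<bullet> x
      + (switching t l \<mu> \<bullet> u + \<mu> * con_const P t))) x :>
    fst D + (transpose (state_mat P t) *v l + \<mu> *\<^sub>R con_state P t)"
    by (intro GDERIV_add GDERIV_fst[OF assms] lin)
  then show "GDERIV (\<lambda>x. hamiltonian P t x u l \<mu>) x :>
    fst D + (transpose (state_mat P t) *v l + \<mu> *\<^sub>R con_state P t)"
    by (simp add: hamiltonian_eq algebra_simps)
qed

text \<open>Convexity of U keeps the segment from w to v inside U, and the one-sided quotients along
  it give the linear inequality; the gradient inequality for concave functions gives the converse.
  The linear form is the one that integration against v - w can reach.\<close>

lemma hamiltonian_max_iff:
  assumes conc: "concave_on UNIV (F t)" and D: "GDERIV (F t) (x, w) :> D" and w: "w \<in> U"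
  shows "(\<forall>v\<in>U. hamiltonian P t x v l \<mu> \<le> hamiltonian P t x w l \<mu>) \<longleftrightarrow>
    (\<forall>v\<in>U. (snd D + switching t l \<mu>) \<bullet> (v - w) \<le> 0)"
proof (intro iffI ballI)
  fix v assume max: "\<forall>v\<in>U. hamiltonian P t x v l \<mu> \<le> hamiltonian P t x w l \<mu>" and v: "v \<in> U"
  have "(F t ((x, w) + (1 / Suc n) *\<^sub>R (0, v - w)) - F t (x, w)) * Suc n \<le> - (switching t l \<mu> \<bullet> (v - w))" for n
  proof -
    define \<theta> where "\<theta> = 1 / real (Suc n)"
    have \<theta>: "0 < \<theta>" "\<theta> \<le> 1" "real (Suc n) = 1 / \<theta>" by (auto simp: \<theta>_def)
    have "(1 - \<theta>) *\<^sub>R w + \<theta> *\<^sub>R v \<in> U" using U_convex v w \<theta> by (auto intro: convexD)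
    then have "w + \<theta> *\<^sub>R (v - w) \<in> U" by (simp add: algebra_simps)
    then have "F t (x, w + \<theta> *\<^sub>R (v - w)) - F t (x, w) \<le> \<theta> * - (switching t l \<mu> \<bullet> (v - w))"
      using max by (force simp: hamiltonian_eq inner_add_right)
    then show ?thesis using \<theta> unfolding \<theta>(3) by (simp add: field_simps)
  qed
  then have "(0, v - w) \<bullet> D \<le> - (switching t l \<mu> \<bullet> (v - w))"
    by (intro LIMSEQ_le_const2[OF GDERIV_imp_LIMSEQ[OF D]]) auto
  then show "(snd D + switching t l \<mu>) \<bullet> (v - w) \<le> 0"
    by (simp add: inner_prod_def inner_add_left inner_add_right inner_commute)
next
  fix v assume le: "\<forall>v\<in>U. (snd D + switching t l \<mu>) \<bullet> (v - w) \<le> 0" and v: "v \<in> U"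
  have "F t (x, v) \<le> F t (x, w) + ((x, v) - (x, w)) \<bullet> D" by (rule concave_on_le_gradient[OF conc D])
  then have "F t (x, v) \<le> F t (x, w) + snd D \<bullet> (v - w)" by (simp add: inner_prod_def inner_commute)
  then show "hamiltonian P t x v l \<mu> \<le> hamiltonian P t x w l \<mu>"
    using le v by (force simp: hamiltonian_eq inner_diff_right inner_add_left)
qed

text \<open>The full gradient of the running payoff along the trajectory: its first component drives
  the adjoint equation, its second enters the maximum condition.\<close>

definition state_gradient :: "(real \<Rightarrow> real^'m) \<Rightarrow> real \<Rightarrow> (real^'n) \<times> (real^'m)" where
  "state_gradient w t = gradient (F t) (trajectory P w t, w t)"

lemma state_gradient_GDERIV: "AE t in M. GDERIV (F t) (trajectory P w t, w t) :> state_gradient w t"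
  using F_C1 by eventually_elim (simp add: state_gradient_def C1_imp_GDERIV)

lemma state_gradient_measurable:
  assumes "w \<in> admissible P"
  shows "state_gradient w \<in> borel_measurable M"
  by (rule borel_measurable_gradient_Caratheodory[OF _ F_measurable F_continuous _ state_gradient_GDERIV])
     (use assms in \<open>auto intro: borel_measurable_Pair trajectory_measurable admissible_measurable\<close>)

text \<open>The growth bound constrains \<open>f\<close> only for controls in \<open>U\<close>, but it holds for all states; together
  with concavity this bounds the state component of the gradient.\<close>
lemma state_gradient_integrable:
  assumes w: "w \<in> admissible P"
  shows "integrable M (\<lambda>t. fst (state_gradient w t))"
proof -
  obtain R where "0 \<le> R" and R: "\<And>u t. u \<in> admissible P \<Longrightarrow> t \<in> {0..T} \<Longrightarrow> norm (trajectory P u t) \<le> R"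
    by (rule trajectory_bounded, rule that)
  obtain k where "0 \<le> k" and k: "\<And>t x u. t \<in> {0..T} \<Longrightarrow> norm x \<le> R + 1 \<Longrightarrow> u \<in> U \<Longrightarrow> \<bar>f t x u\<bar> \<le> k"
    by (rule payoff_density_bound[of "R + 1"], rule that)
  show ?thesis
  proof (rule integrable_lebesgue_on_bounded)
    show "(\<lambda>t. fst (state_gradient w t)) \<in> borel_measurable M"
      by (rule measurable_compose[OF state_gradient_measurable[OF w]])
         (intro borel_measurable_continuous_onI continuous_intros)
    show "AE t in M. norm (fst (state_gradient w t)) \<le> 2 * k"
      using F_concave state_gradient_GDERIV[of w] admissible_AE[OF w] AE_space
    proof eventually_elim
      fix t assume c: "concave_on UNIV (F t)" and D: "GDERIV (F t) (trajectory P w t, w t) :> state_gradient w t"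
        and wU: "w t \<in> U" and "t \<in> space M"
      then have t: "t \<in> {0..T}" by simp
      \<comment> \<open>A step of length at most 1 against the state gradient; it stays in the ball
        of radius R + 1 on which k bounds the payoff, and it keeps the control in U.\<close>
      define e where "e = sgn (fst (state_gradient w t))"
      have e: "norm e \<le> 1" "e \<bullet> fst (state_gradient w t) = norm (fst (state_gradient w t))"
        by (simp_all add: e_def norm_sgn inner_sgn_self)
      have "F t (trajectory P w t - e, w t) \<le> F t (trajectory P w t, w t)
          + ((trajectory P w t - e, w t) - (trajectory P w t, w t)) \<bullet> state_gradient w t"
        by (rule concave_on_le_gradient[OF c D])
      then have "f t (trajectory P w t - e) (w t) \<le> f t (trajectory P w t) (w t) - norm (fst (state_gradient w t))"
        by (simp add: inner_prod_def e)
      moreover have "norm (trajectory P w t) \<le> R" by (rule R[OF w t])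
      moreover have "norm (trajectory P w t - e) \<le> R + 1"
        using norm_triangle_ineq4[of "trajectory P w t" e] e(1) R[OF w t] by linarith
      ultimately show "norm (fst (state_gradient w t)) \<le> 2 * k"
        using k[OF t _ wU, of "trajectory P w t"] k[OF t _ wU, of "trajectory P w t - e"] by simp
    qed
  qed
qed

text \<open>The value at T is prescribed, so the equation is solved backwards, with integrals over
  {t..T}. Maximality of w is not assumed.\<close>

lemma adjoint_exists:
  assumes w: "w \<in> admissible P"
  obtains l where "l T = l1" "weak_derivative T l
    (\<lambda>t. - (fst (state_gradient w t) + (transpose (state_mat P t) *v l t + \<mu> *\<^sub>R con_state P t)))"
proof -
  define G where "G t = fst (state_gradient w t) + \<mu> *\<^sub>R con_state P t" for t
  have "integrable M (con_state P)"
  proof -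
    obtain a where "\<And>t. t \<in> {0..T} \<Longrightarrow> norm (con_state P t) \<le> a"
      using con_state unfolding bounded_measurable_def bounded_iff by blast
    then show ?thesis using con_state
      by (intro integrable_lebesgue_on_bounded[where C=a] AE_time) (auto simp: bounded_measurable_def)
  qed
  then have iG: "integrable M G" using state_gradient_integrable[OF w] by (simp add: G_def[abs_def])
  have ion: "v integrable_on {a..b}" if "integrable M v" "0 \<le> a" "b \<le> T" for v :: "real \<Rightarrow> real^'n" and a b
    using that by (intro integrable_on_lebesgue_on_interval[OF that(1)]) auto
  have cg: "continuous_on {0..T} (\<lambda>t. l1 + integral {t..T} G)"
    by (intro continuous_intros indefinite_integral_continuous_1' ion iG) auto
  obtain l where l: "continuous_on {0..T} l" and lt: "\<And>t. t \<in> {0..T} \<Longrightarrow>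
      l t = (l1 + integral {t..T} G) + integral {t..T} (\<lambda>s. transpose (state_mat P s) *v l s)"
    using linear_Volterra_backward[OF less_imp_le[OF T_pos] bounded_measurable_transpose[OF state_mat] cg] by blast
  obtain r where r: "\<And>t. t \<in> {0..T} \<Longrightarrow> norm (l t) \<le> r" using continuous_bounded[OF l] by blast
  obtain K where K: "0 < K" "\<And>t x. t \<in> {0..T} \<Longrightarrow> norm (transpose (state_mat P t) *v x) \<le> K * norm x"
    using bounded_measurable_matrix_boundE[OF bounded_measurable_transpose[OF state_mat]] by blast
  have iA: "integrable M (\<lambda>t. transpose (state_mat P t) *v l t)"
  proof (rule integrable_lebesgue_on_bounded)
    show "(\<lambda>t. transpose (state_mat P t) *v l t) \<in> borel_measurable M"
      using borel_measurable_lebesgue_on_continuous[OF l] by measurable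
    show "AE t in M. norm (transpose (state_mat P t) *v l t) \<le> K * r"
      by (rule AE_time, rule order_trans[OF K(2) mult_left_mono[OF r]]) (use K(1) in auto)
  qed
  define k where "k t = G t + transpose (state_mat P t) *v l t" for t
  have ik: "integrable M k" using iG iA by (simp add: k_def[abs_def])
  have lk: "l t = l1 + integral {t..T} k" if t: "t \<in> {0..T}" for t
  proof -
    have "G integrable_on {t..T}" by (rule ion[OF iG]) (use t in auto)
    moreover have "(\<lambda>t. transpose (state_mat P t) *v l t) integrable_on {t..T}" by (rule ion[OF iA]) (use t in auto)
    ultimately show ?thesis
      unfolding lt[OF t] k_def by (simp only: Henstock_Kurzweil_Integration.integral_add add.assoc)
  qed
  show thesis
  proof
    show "l T = l1" using lk[of T] T_pos by simp
    have "weak_derivative T l (\<lambda>t. - k t)"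
    proof (rule weak_derivativeI)
      fix t assume t: "t \<in> {0..T}"
      have "integral {0..t} k + integral {t..T} k = integral {0..T} k"
        using t by (intro Henstock_Kurzweil_Integration.integral_combine ion ik) auto
      then show "l t = l 0 + integral {0..t} (\<lambda>t. - k t)"
        using lk[OF t] lk[of 0] T_pos by (simp add: algebra_simps)
    qed (use ik in simp)
    then show "weak_derivative T l
      (\<lambda>t. - (fst (state_gradient w t) + (transpose (state_mat P t) *v l t + \<mu> *\<^sub>R con_state P t)))"
      by (simp add: k_def G_def ac_simps)
  qed
qed

text \<open>Integration by parts of l against the difference of trajectories, which vanishes at 0.
  The terms with the state matrix cancel, as do those with \<open>con_state\<close>, because the
  constraint density is affine. What remains is an identity, shared by the sufficiency and the
  necessity proof.\<close>

lemma adjoint_duality: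
  assumes w: "w \<in> admissible P" and u: "u \<in> admissible P"
    and l: "weak_derivative T l l'"
    and l': "AE t in M. l' t = - (fst (state_gradient w t) + (transpose (state_mat P t) *v l t + \<mu> *\<^sub>R con_state P t))"
  defines "r \<equiv> \<lambda>t. switching t (l t) \<mu> \<bullet> (u t - w t) - fst (state_gradient w t) \<bullet> (trajectory P u t - trajectory P w t)"
  shows "integrable M r"
    and "l T \<bullet> (trajectory P u T - trajectory P w T) + \<mu> * (C u - C w) = (LINT t|M. r t)"
proof -
  define \<delta> where "\<delta> t = trajectory P u t - trajectory P w t" for t
  define \<delta>' where "\<delta>' t = state_mat P t *v \<delta> t + control_mat P t *v (u t - w t)" for t
  define h where "h t = con_density P t (trajectory P u t) (u t) - con_density P t (trajectory P w t) (w t)" for t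
  have d: "weak_derivative T \<delta> \<delta>'"
    using trajectory_difference[OF u trajectory_0[OF u] trajectory_weak_derivative[OF u]
        w trajectory_0[OF w] trajectory_weak_derivative[OF w]]
    by (simp add: \<delta>_def[abs_def] \<delta>'_def[abs_def])
  have d0: "\<delta> 0 = 0" using u w by (simp add: \<delta>_def trajectory_0)
  note bp = integral_by_parts_weak_derivative[OF l d less_imp_le[OF T_pos]]
  have ih: "integrable M h" unfolding h_def[abs_def]
    using trajectory_con_integrable[OF u] trajectory_con_integrable[OF w] by simp
  have hC: "(LINT t|M. h t) = C u - C w" unfolding h_def constraint_def
    using trajectory_con_integrable[OF u] trajectory_con_integrable[OF w] by simp
  have i: "integrable M (\<lambda>t. l' t \<bullet> \<delta> t + l t \<bullet> \<delta>' t + \<mu> * h t)"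
    using bp ih by simp
  have ae: "AE t in M. l' t \<bullet> \<delta> t + l t \<bullet> \<delta>' t + \<mu> * h t = r t"
    using l'
  proof eventually_elim
    fix t assume l': "l' t = - (fst (state_gradient w t) + (transpose (state_mat P t) *v l t + \<mu> *\<^sub>R con_state P t))"
    have hh: "h t = con_state P t \<bullet> \<delta> t + con_control P t \<bullet> (u t - w t)"
      by (simp add: h_def con_density_def \<delta>_def inner_diff_right)
    show "l' t \<bullet> \<delta> t + l t \<bullet> \<delta>' t + \<mu> * h t = r t"
      unfolding l' hh \<delta>'_def r_def \<delta>_def[symmetric] switching_def inner_add_right[of "l t"] inner_matrix_vector_transpose
      by (simp add: inner_add_left inner_diff_left algebra_simps)
  qed
  have "(\<lambda>t. l' t \<bullet> \<delta> t + l t \<bullet> \<delta>' t + \<mu> * h t) \<in> borel_measurable M" using i by auto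
  then have rm: "r \<in> borel_measurable M"
    by (rule borel_measurable_lebesgue_on_cong_AE[rotated]) (use ae in auto)
  show ir: "integrable M r" by (rule integrable_cong_AE_imp[OF i rm ae])
  have "(LINT t|M. r t) = (LINT t|M. l' t \<bullet> \<delta> t + l t \<bullet> \<delta>' t + \<mu> * h t)"
    by (rule integral_cong_AE[symmetric]) (use i rm ae in auto)
  also have "\<dots> = (LINT t|M. l' t \<bullet> \<delta> t) + (LINT t|M. l t \<bullet> \<delta>' t) + \<mu> * (C u - C w)"
    using bp ih by (simp add: hC)
  also have "\<dots> = l T \<bullet> \<delta> T + \<mu> * (C u - C w)" using bp(3) d0 by simp
  finally show "l T \<bullet> (trajectory P u T - trajectory P w T) + \<mu> * (C u - C w) = (LINT t|M. r t)"
    by (simp add: \<delta>_def)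
qed

section \<open>Equivalence of Pontryagin's conditions and maximality\<close>

lemma \<phi>_GDERIV: "GDERIV \<phi> z :> gradient \<phi> z"
  by (rule C1_imp_GDERIV[OF \<phi>_C1])

text \<open>The transversality condition bounds the terminal increment by the boundary term of
  \<open>adjoint_duality\<close>. After adding r to the increment of the running payoff, the state
  gradient cancels against r, and concavity leaves only the term that the maximum condition makes
  nonpositive.\<close>

lemma pontryagin_imp_maximizes:
  assumes w: "w \<in> admissible P"
    and l: "weak_derivative T l l'"
    and l': "AE t in M. l' t = - (fst (state_gradient w t) + (transpose (state_mat P t) *v l t + \<mu> *\<^sub>R con_state P t))"
    and max: "AE t in M. \<forall>v\<in>U. (snd (state_gradient w t) + switching t (l t) \<mu>) \<bullet> (v - w t) \<le> 0"
    and lT: "l T = gradient \<phi> (trajectory P w T)"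
  shows "maximizes \<mu> w"
  unfolding maximizes_def
proof (intro conjI ballI w)
  fix u assume u: "u \<in> admissible P"
  define r where "r t = switching t (l t) \<mu> \<bullet> (u t - w t)
    - fst (state_gradient w t) \<bullet> (trajectory P u t - trajectory P w t)" for t
  have r: "integrable M r" "l T \<bullet> (trajectory P u T - trajectory P w T) + \<mu> * (C u - C w) = (LINT t|M. r t)"
    using adjoint_duality[OF w u l l'] by (simp_all add: r_def[abs_def])
  have "\<phi> (trajectory P u T) \<le> \<phi> (trajectory P w T) + (trajectory P u T - trajectory P w T) \<bullet> l T"
    unfolding lT by (rule concave_on_le_gradient[OF \<phi>_concave \<phi>_GDERIV])
  moreover have "(LINT t|M. f t (trajectory P u t) (u t)) - (LINT t|M. f t (trajectory P w t) (w t)) + (LINT t|M. r t)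
      = (LINT t|M. f t (trajectory P u t) (u t) - f t (trajectory P w t) (w t) + r t)"
    using r trajectory_payoff_integrable u w by simp
  moreover have "\<dots> \<le> (LINT t|M. 0)"
  proof (rule integral_mono_AE)
    show "AE t in M. f t (trajectory P u t) (u t) - f t (trajectory P w t) (w t) + r t \<le> 0"
      using max F_concave state_gradient_GDERIV[of w] admissible_AE[OF u]
    proof eventually_elim
      fix t assume m: "\<forall>v\<in>U. (snd (state_gradient w t) + switching t (l t) \<mu>) \<bullet> (v - w t) \<le> 0"
        and c: "concave_on UNIV (F t)" and D: "GDERIV (F t) (trajectory P w t, w t) :> state_gradient w t"
        and uU: "u t \<in> U"
      have "F t (trajectory P u t, u t) \<le> F t (trajectory P w t, w t)
          + ((trajectory P u t, u t) - (trajectory P w t, w t)) \<bullet> state_gradient w t"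
        by (rule concave_on_le_gradient[OF c D])
      then show "f t (trajectory P u t) (u t) - f t (trajectory P w t) (w t) + r t \<le> 0"
        using m[rule_format, OF uU] by (simp add: r_def inner_prod_def inner_add_left inner_add_right inner_commute)
    qed
  qed (use r trajectory_payoff_integrable u w in auto)
  ultimately show "J u + \<mu> * C u \<le> J w + \<mu> * C w"
    using r(2) unfolding payoff_def by (simp add: inner_commute algebra_simps)
qed

text \<open>The difference quotients of the integrand along \<open>w + \<theta> (v - w)\<close> increase as \<open>\<theta>\<close> decreases, so
  monotone convergence yields the integrability of the directional derivative, for which no bound is
  available a priori.\<close>
lemma maximizes_imp_variational_inequality:
  assumes m: "maximizes \<mu> w" and v: "v \<in> admissible P"
    and l: "weak_derivative T l l'"
    and l': "AE t in M. l' t = - (fst (state_gradient w t) + (transpose (state_mat P t) *v l t + \<mu> *\<^sub>R con_state P t))"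
    and lT: "l T = gradient \<phi> (trajectory P w T)"
  shows "integrable M (\<lambda>t. (snd (state_gradient w t) + switching t (l t) \<mu>) \<bullet> (v t - w t))"
    and "(LINT t|M. (snd (state_gradient w t) + switching t (l t) \<mu>) \<bullet> (v t - w t)) \<le> 0"
proof -
  have w: "w \<in> admissible P" using m by (simp add: maximizes_def)
  define \<theta> where "\<theta> n = 1 / real (Suc n)" for n
  have \<theta>: "0 < \<theta> n" "0 \<le> \<theta> n" "\<theta> n \<le> 1" "real (Suc n) = 1 / \<theta> n" "\<theta> (Suc n) \<le> \<theta> n" for n
    by (auto simp: \<theta>_def frac_le)
  define u where "u n t = (1 - \<theta> n) *\<^sub>R w t + \<theta> n *\<^sub>R v t" for n t
  have u: "u n \<in> admissible P" for n unfolding u_def[abs_def] by (rule admissible_convex[OF w v \<theta>(2,3)])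
  have xu: "trajectory P (u n) t = trajectory P w t + \<theta> n *\<^sub>R (trajectory P v t - trajectory P w t)" if "t \<in> {0..T}" for n t
    unfolding u_def[abs_def] trajectory_affine[OF w v \<theta>(2,3) that] by (simp add: algebra_simps)
  have uu: "u n t = w t + \<theta> n *\<^sub>R (v t - w t)" for n t by (simp add: u_def algebra_simps)
  have Cu: "C (u n) - C w = \<theta> n * (C v - C w)" for n
    unfolding u_def[abs_def] constraint_affine[OF w v \<theta>(2,3)] by (simp add: algebra_simps)
  define \<delta> where "\<delta> t = (trajectory P v t - trajectory P w t, v t - w t)" for t
  define D where "D t = \<delta> t \<bullet> state_gradient w t" for t
  define q where "q n t = (f t (trajectory P (u n) t) (u n t) - f t (trajectory P w t) (w t)) * Suc n" for n t
  define p where "p n = (\<phi> (trajectory P (u n) T) - \<phi> (trajectory P w T)) * Suc n" for n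
  have q_eq: "q n t = (F t ((trajectory P w t, w t) + \<theta> n *\<^sub>R \<delta> t) - F t (trajectory P w t, w t)) / \<theta> n"
    if "t \<in> {0..T}" for n t
    unfolding q_def \<theta>(4) by (simp add: xu[OF that] uu \<delta>_def)
  have iq: "integrable M (q n)" for n
    unfolding q_def[abs_def] using trajectory_payoff_integrable u w by simp
  have mono_q: "AE t in M. mono (\<lambda>n. q n t)"
    using F_concave AE_space
  proof eventually_elim
    fix t assume c: "concave_on UNIV (F t)" and "t \<in> space M"
    then have t: "t \<in> {0..T}" by simp
    show "mono (\<lambda>n. q n t)"
      unfolding mono_iff_le_Suc q_eq[OF t]
      by (intro allI concave_on_difference_quotient_antimono[OF c]) (use \<theta> in auto)
  qed
  have lim_q: "AE t in M. (\<lambda>n. q n t) \<longlonglongrightarrow> D t"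
    using state_gradient_GDERIV[of w] AE_space
  proof eventually_elim
    fix t assume g: "GDERIV (F t) (trajectory P w t, w t) :> state_gradient w t" and "t \<in> space M"
    then have t: "t \<in> {0..T}" by simp
    show "(\<lambda>n. q n t) \<longlonglongrightarrow> D t"
      using GDERIV_imp_LIMSEQ[OF g, of "\<delta> t"] unfolding q_eq[OF t] D_def \<theta>_def by simp
  qed
  \<comment> \<open>Maximality of w is tested against \<open>u n\<close> and divided by the step;
    since the constraint is affine, its quotient is exactly C v - C w for every n.\<close>
  have int_q: "(LINT t|M. q n t) \<le> - \<mu> * (C v - C w) - p n" for n
  proof -
    have "(LINT t|M. q n t) = ((J (u n) - \<phi> (trajectory P (u n) T)) - (J w - \<phi> (trajectory P w T))) * Suc n"
      unfolding q_def payoff_def using trajectory_payoff_integrable u w by simp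
    then have "(LINT t|M. q n t) + p n = (J (u n) - J w) / \<theta> n"
      unfolding p_def \<theta>(4) by (simp add: diff_divide_distrib)
    also have "\<dots> \<le> (- \<mu> * (C (u n) - C w)) / \<theta> n"
      using m u \<theta>(1) by (intro divide_right_mono) (auto simp: maximizes_def algebra_simps less_imp_le)
    also have "\<dots> = - \<mu> * (C v - C w)" unfolding Cu using \<theta>(1)[of n] by simp
    finally show ?thesis by simp
  qed
  have p_eq: "p n = (\<phi> (trajectory P w T + \<theta> n *\<^sub>R (trajectory P v T - trajectory P w T)) - \<phi> (trajectory P w T)) / \<theta> n" for n
    unfolding p_def \<theta>(4) using T_pos by (simp add: xu)
  \<comment> \<open>The terminal quotients increase as well, so p 0 turns \<open>int_q\<close> into
    an upper bound independent of n, as monotone convergence requires.\<close>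
  have mono_p: "p 0 \<le> p n" for n
  proof -
    have "mono p" unfolding mono_iff_le_Suc p_eq
      by (intro allI concave_on_difference_quotient_antimono[OF \<phi>_concave]) (use \<theta> in auto)
    then show ?thesis by (simp add: monoD)
  qed
  have lim_p: "p \<longlonglongrightarrow> (trajectory P v T - trajectory P w T) \<bullet> l T"
    using GDERIV_imp_LIMSEQ[OF \<phi>_GDERIV[of "trajectory P w T"], of "trajectory P v T - trajectory P w T"]
    unfolding p_eq[abs_def] lT \<theta>_def by simp
  have "incseq (\<lambda>n. LINT t|M. q n t)"
  proof (rule incseq_SucI, rule integral_mono_AE[OF iq iq])
    show "AE t in M. q n t \<le> q (Suc n) t" for n
      using mono_q
    proof eventually_elim
      fix t assume "mono (\<lambda>n. q n t)"
      from monoD[OF this, of n "Suc n"] show "q n t \<le> q (Suc n) t" by simp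
    qed
  qed
  moreover have "(LINT t|M. q n t) \<le> - \<mu> * (C v - C w) - p 0" for n
    using int_q[of n] mono_p[of n] by simp
  ultimately obtain L where L: "(\<lambda>n. LINT t|M. q n t) \<longlonglongrightarrow> L"
    by (meson incseq_convergent)
  have L_le: "L \<le> - \<mu> * (C v - C w) - (trajectory P v T - trajectory P w T) \<bullet> l T"
    by (rule LIMSEQ_le[OF L tendsto_diff[OF tendsto_const lim_p]]) (use int_q in auto)
  have Dm: "D \<in> borel_measurable M"
    unfolding D_def[abs_def] \<delta>_def
    using state_gradient_measurable[OF w] trajectory_measurable[OF v] trajectory_measurable[OF w]
      admissible_measurable[OF v] admissible_measurable[OF w] by measurable
  have D: "integrable M D" "(LINT t|M. D t) = L"
    using integrable_monotone_convergence[OF iq mono_q lim_q L Dm] integral_monotone_convergence[OF iq mono_q lim_q L Dm]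
    by auto
  define r where "r t = switching t (l t) \<mu> \<bullet> (v t - w t)
    - fst (state_gradient w t) \<bullet> (trajectory P v t - trajectory P w t)" for t
  have r: "integrable M r" "l T \<bullet> (trajectory P v T - trajectory P w T) + \<mu> * (C v - C w) = (LINT t|M. r t)"
    using adjoint_duality[OF w v l l'] by (simp_all add: r_def[abs_def])
  \<comment> \<open>The state component of the gradient occurs in D and r with opposite signs, so
    only the control term survives.\<close>
  have eq: "(\<lambda>t. (snd (state_gradient w t) + switching t (l t) \<mu>) \<bullet> (v t - w t)) = (\<lambda>t. D t + r t)"
    by (auto simp: fun_eq_iff D_def r_def \<delta>_def inner_prod_def inner_add_left inner_add_right inner_commute)
  show "integrable M (\<lambda>t. (snd (state_gradient w t) + switching t (l t) \<mu>) \<bullet> (v t - w t))"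
    unfolding eq using D r by simp
  show "(LINT t|M. (snd (state_gradient w t) + switching t (l t) \<mu>) \<bullet> (v t - w t)) \<le> 0"
    unfolding eq using D r L_le by (simp add: inner_commute)
qed

text \<open>The adjoint state is fixed first and depends only on w and \<mu>, so the variational
  inequality may be applied with the same l to every switched control.\<close>

lemma maximizes_imp_pontryagin:
  assumes m: "maximizes \<mu> w"
  obtains l where "l T = gradient \<phi> (trajectory P w T)"
    "weak_derivative T l (\<lambda>t. - (fst (state_gradient w t) + (transpose (state_mat P t) *v l t + \<mu> *\<^sub>R con_state P t)))"
    "AE t in M. \<forall>v\<in>U. (snd (state_gradient w t) + switching t (l t) \<mu>) \<bullet> (v - w t) \<le> 0"
proof -
  have w: "w \<in> admissible P" using m by (simp add: maximizes_def)
  obtain l where lT: "l T = gradient \<phi> (trajectory P w T)" and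
    l: "weak_derivative T l (\<lambda>t. - (fst (state_gradient w t) + (transpose (state_mat P t) *v l t + \<mu> *\<^sub>R con_state P t)))"
    by (rule adjoint_exists[OF w])
  define s where "s t = snd (state_gradient w t) + switching t (l t) \<mu>" for t
  have [measurable]: "s \<in> borel_measurable M"
  proof -
    have "(\<lambda>t. snd (state_gradient w t)) \<in> borel_measurable M"
      by (rule measurable_compose[OF state_gradient_measurable[OF w]])
         (intro borel_measurable_continuous_onI continuous_intros)
    then show ?thesis unfolding s_def[abs_def] switching_def
      using borel_measurable_lebesgue_on_continuous[OF continuous_on_weak_derivative[OF l]] by measurable
  qed
  note [measurable] = admissible_measurable[OF w]
  have AE_c: "AE t in M. s t \<bullet> (c - w t) \<le> 0" if c: "c \<in> U" for c
  proof -
    \<comment> \<open>The constant c replaces w exactly where the desired inequality fails. The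
      integrand becomes a positive part with integral at most 0, hence vanishes almost
      everywhere.\<close>
    define v where "v t = (if 0 < s t \<bullet> (c - w t) then c else w t)" for t
    have v: "v \<in> admissible P"
    proof (rule admissibleI)
      show "v \<in> borel_measurable M" unfolding v_def[abs_def] by measurable
      show "AE t in M. v t \<in> U" using admissible_AE[OF w] by eventually_elim (simp add: v_def c)
    qed
    have v_eq: "s t \<bullet> (v t - w t) = max 0 (s t \<bullet> (c - w t))" for t
      by (simp add: v_def max_def)
    have "integrable M (\<lambda>t. max 0 (s t \<bullet> (c - w t)))" "(LINT t|M. max 0 (s t \<bullet> (c - w t))) \<le> 0"
      using maximizes_imp_variational_inequality[OF m v l _ lT] unfolding s_def[symmetric] v_eq by auto
    moreover have "0 \<le> (LINT t|M. max 0 (s t \<bullet> (c - w t)))" by (rule integral_nonneg_AE) simp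
    ultimately have "AE t in M. max 0 (s t \<bullet> (c - w t)) = 0"
      by (subst integral_nonneg_eq_0_iff_AE[symmetric]) auto
    then show ?thesis by eventually_elim (simp add: max_def split: if_splits)
  qed
  \<comment> \<open>The exceptional null set in \<open>AE_c\<close> depends on c. A countable dense
    set leaves a single null set, and the inequality extends to U because it defines a closed
    half-space in v.\<close>
  obtain Q where Q: "countable Q" "Q \<subseteq> U" "U \<subseteq> closure Q" using separable[of U] by blast
  have "AE t in M. \<forall>c\<in>Q. s t \<bullet> (c - w t) \<le> 0"
    using Q AE_c by (subst AE_ball_countable) auto
  then have "AE t in M. \<forall>v\<in>U. s t \<bullet> (v - w t) \<le> 0"
  proof eventually_elim
    fix t assume q: "\<forall>c\<in>Q. s t \<bullet> (c - w t) \<le> 0"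
    have "closure Q \<subseteq> {v. s t \<bullet> v \<le> s t \<bullet> w t}"
      using q by (intro closure_minimal closed_halfspace_le) (auto simp: inner_diff_right)
    then show "\<forall>v\<in>U. s t \<bullet> (v - w t) \<le> 0" using Q(3) by (auto simp: inner_diff_right)
  qed
  then show thesis using that[OF lT l] by (simp add: s_def)
qed

lemma pontryagin_iff_maximizes:
  assumes w: "w \<in> admissible P"
  shows "(\<exists>l l'. weak_derivative T l l' \<and>
      (AE t in M. l' t = - gradient (\<lambda>x. hamiltonian P t x (w t) (l t) \<mu>) (trajectory P w t) \<and>
         is_arg_max (\<lambda>v. hamiltonian P t (trajectory P w t) v (l t) \<mu>) (\<lambda>v. v \<in> U) (w t)) \<and>
      l T = gradient \<phi> (trajectory P w T)) \<longleftrightarrow> maximizes \<mu> w"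
proof -
  \<comment> \<open>Quantifying over l inside the almost-everywhere statement makes the null set
    independent of the adjoint state, so l t can be inserted at each time.\<close>
  have grad: "AE t in M. \<forall>l. gradient (\<lambda>x. hamiltonian P t x (w t) l \<mu>) (trajectory P w t) =
      fst (state_gradient w t) + (transpose (state_mat P t) *v l + \<mu> *\<^sub>R con_state P t)"
    using state_gradient_GDERIV[of w] by eventually_elim (simp add: gradient_hamiltonian)
  have max: "AE t in M. \<forall>l. is_arg_max (\<lambda>v. hamiltonian P t (trajectory P w t) v l \<mu>) (\<lambda>v. v \<in> U) (w t) \<longleftrightarrow>
      (\<forall>v\<in>U. (snd (state_gradient w t) + switching t l \<mu>) \<bullet> (v - w t) \<le> 0)"
    using state_gradient_GDERIV[of w] F_concave admissible_AE[OF w]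
  proof eventually_elim
    fix t assume "GDERIV (F t) (trajectory P w t, w t) :> state_gradient w t" "concave_on UNIV (F t)" "w t \<in> U"
    from hamiltonian_max_iff[OF this(2,1,3)] \<open>w t \<in> U\<close>
    show "\<forall>l. is_arg_max (\<lambda>v. hamiltonian P t (trajectory P w t) v l \<mu>) (\<lambda>v. v \<in> U) (w t) \<longleftrightarrow>
      (\<forall>v\<in>U. (snd (state_gradient w t) + switching t l \<mu>) \<bullet> (v - w t) \<le> 0)"
      by (auto simp: is_arg_max_def not_less)
  qed
  show ?thesis
  proof
    assume "\<exists>l l'. weak_derivative T l l' \<and>
      (AE t in M. l' t = - gradient (\<lambda>x. hamiltonian P t x (w t) (l t) \<mu>) (trajectory P w t) \<and>
         is_arg_max (\<lambda>v. hamiltonian P t (trajectory P w t) v (l t) \<mu>) (\<lambda>v. v \<in> U) (w t)) \<and>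
      l T = gradient \<phi> (trajectory P w T)"
    then obtain l l' where l: "weak_derivative T l l'" "l T = gradient \<phi> (trajectory P w T)" and
      ae: "AE t in M. l' t = - gradient (\<lambda>x. hamiltonian P t x (w t) (l t) \<mu>) (trajectory P w t) \<and>
         is_arg_max (\<lambda>v. hamiltonian P t (trajectory P w t) v (l t) \<mu>) (\<lambda>v. v \<in> U) (w t)" by blast
    show "maximizes \<mu> w"
    proof (rule pontryagin_imp_maximizes[OF w l(1) _ _ l(2)])
      show "AE t in M. l' t = - (fst (state_gradient w t) + (transpose (state_mat P t) *v l t + \<mu> *\<^sub>R con_state P t))"
        using ae grad by eventually_elim simp
      show "AE t in M. \<forall>v\<in>U. (snd (state_gradient w t) + switching t (l t) \<mu>) \<bullet> (v - w t) \<le> 0"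
        using ae max by eventually_elim simp
    qed
  next
    assume "maximizes \<mu> w"
    then obtain l where l: "l T = gradient \<phi> (trajectory P w T)"
      "weak_derivative T l (\<lambda>t. - (fst (state_gradient w t) + (transpose (state_mat P t) *v l t + \<mu> *\<^sub>R con_state P t)))"
      "AE t in M. \<forall>v\<in>U. (snd (state_gradient w t) + switching t (l t) \<mu>) \<bullet> (v - w t) \<le> 0"
      by (rule maximizes_imp_pontryagin)
    have "AE t in M. - (fst (state_gradient w t) + (transpose (state_mat P t) *v l t + \<mu> *\<^sub>R con_state P t))
        = - gradient (\<lambda>x. hamiltonian P t x (w t) (l t) \<mu>) (trajectory P w t) \<and>
         is_arg_max (\<lambda>v. hamiltonian P t (trajectory P w t) v (l t) \<mu>) (\<lambda>v. v \<in> U) (w t)"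
      using l(3) grad max by eventually_elim simp
    then show "\<exists>l l'. weak_derivative T l l' \<and>
      (AE t in M. l' t = - gradient (\<lambda>x. hamiltonian P t x (w t) (l t) \<mu>) (trajectory P w t) \<and>
         is_arg_max (\<lambda>v. hamiltonian P t (trajectory P w t) v (l t) \<mu>) (\<lambda>v. v \<in> U) (w t)) \<and>
      l T = gradient \<phi> (trajectory P w T)"
      using l(1,2) by blast
  qed
qed

lemma pontryagin_multipliers_iff:
  "\<mu> \<in> pontryagin_multipliers P B \<longleftrightarrow> (\<exists>w. optimal_control P B w \<and> maximizes \<mu> w)"
proof -
  have "\<mu> \<in> pontryagin_multipliers P B \<longleftrightarrow> (\<exists>w. optimal_control P B w \<and>
    (\<exists>l l'. weak_derivative T l l' \<and>
      (AE t in M. l' t = - gradient (\<lambda>x. hamiltonian P t x (w t) (l t) \<mu>) (trajectory P w t) \<and>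
         is_arg_max (\<lambda>v. hamiltonian P t (trajectory P w t) v (l t) \<mu>) (\<lambda>v. v \<in> U) (w t)) \<and>
      l T = gradient \<phi> (trajectory P w T)))"
    unfolding pontryagin_multipliers_def by blast
  also have "\<dots> \<longleftrightarrow> (\<exists>w. optimal_control P B w \<and> maximizes \<mu> w)"
    by (intro ex_cong1 conj_cong refl pontryagin_iff_maximizes) (simp add: optimal_control_def)
  finally show ?thesis .
qed

section \<open>Identification of the three multiplier sets\<close>

lemma opt_value_eq: "opt_value = value_fun P"
  by (simp add: fun_eq_iff opt_value_def value_fun_def)

lemma supergradients_eq: "supergradients = superdifferential P"
  by (simp add: fun_eq_iff supergradients_def superdifferential_def opt_value_eq value_dom_def)

lemma dual_minimizers_eq: "dual_minimizers = dual_multipliers P"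
  by (simp add: fun_eq_iff dual_minimizers_def dual_multipliers_def dual_def dual_fun_def)

text \<open>For every optimal control the maximality condition is equivalent to the same statement
  about the superdifferential. One optimal control, supplied by attainment, therefore decides the
  existential statement in the Pontryagin set.\<close>

lemma multipliers_agree:
  assumes B: "B \<in> interior (value_dom P)"
  shows "p \<in> superdifferential P B \<longleftrightarrow> - p \<in> pontryagin_multipliers P B"
    and "\<mu> \<in> dual_multipliers P B \<longleftrightarrow> \<mu> \<in> pontryagin_multipliers P B"
proof -
  have B': "B \<in> interior (C ` admissible P)" using B by (simp add: value_dom_def)
  then have "B \<in> C ` admissible P" using interior_subset by blast
  then obtain w where w: "w \<in> admissible P" "C w = B" "opt_value B = ereal (J w)"
    by (rule value_attained)
  have "- p \<in> pontryagin_multipliers P B \<longleftrightarrow> p \<in> superdifferential P B" for p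
  proof -
    have "maximizes (- p) w' \<longleftrightarrow> p \<in> superdifferential P B" if "optimal_control P B w'" for w'
      using that supergradients_iff_maximizes[of w' B p]
      by (simp add: optimal_control_def opt_value_eq supergradients_eq)
    moreover have "optimal_control P B w" using w by (simp add: optimal_control_def opt_value_eq)
    ultimately show ?thesis unfolding pontryagin_multipliers_iff by blast
  qed
  then show sup: "p \<in> superdifferential P B \<longleftrightarrow> - p \<in> pontryagin_multipliers P B" for p by blast
  show "\<mu> \<in> dual_multipliers P B \<longleftrightarrow> \<mu> \<in> pontryagin_multipliers P B"
    using dual_minimizers_iff_maximizes[OF B' w, of \<mu>] supergradients_iff_maximizes[OF w, of "- \<mu>"] sup[of "- \<mu>"]
    by (simp add: dual_minimizers_eq supergradients_eq)
qed

end

theorem theorem3p16: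
  fixes P :: "('n::finite, 'm::finite) control_problem"
  assumes "structured_problem P"
  shows "(\<forall>B. B \<in> interior (value_dom P) \<longleftrightarrow>
            (\<exists>u1\<in>admissible P. \<exists>u2\<in>admissible P. constraint P u1 < B \<and> B < constraint P u2)) \<and>
         (\<forall>B\<in>interior (value_dom P).
            superdifferential P B = uminus ` pontryagin_multipliers P B \<and>
            uminus ` pontryagin_multipliers P B = uminus ` dual_multipliers P B) \<and>
         (\<forall>B\<in>interior (value_dom P). \<forall>d.
            ((\<lambda>B'. real_of_ereal (value_fun P B')) has_real_derivative d) (at B) \<longrightarrow>
            (\<exists>\<mu>. pontryagin_multipliers P B = {\<mu>} \<and> d = - \<mu>))"
proof -
  interpret control_problem_structured P by unfold_locales (rule assms)
  show ?thesis
  proof (intro conjI ballI allI impI)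
    show "B \<in> interior (value_dom P) \<longleftrightarrow>
        (\<exists>u1\<in>admissible P. \<exists>u2\<in>admissible P. constraint P u1 < B \<and> B < constraint P u2)" for B
      using interior_range_iff by (simp add: value_dom_def)
  next
    fix B assume B: "B \<in> interior (value_dom P)"
    show "superdifferential P B = uminus ` pontryagin_multipliers P B"
    proof (intro set_eqI iffI)
      fix p assume "p \<in> superdifferential P B"
      then have "- p \<in> pontryagin_multipliers P B" using multipliers_agree(1)[OF B] by blast
      then show "p \<in> uminus ` pontryagin_multipliers P B" by (rule rev_image_eqI) simp
    next
      fix p assume "p \<in> uminus ` pontryagin_multipliers P B"
      then have "- p \<in> pontryagin_multipliers P B" by force
      then show "p \<in> superdifferential P B" using multipliers_agree(1)[OF B] by blast
    qed
    show "uminus ` pontryagin_multipliers P B = uminus ` dual_multipliers P B"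
      using multipliers_agree(2)[OF B] by (intro arg_cong[where f="image uminus"]) blast
  next
    fix B d assume B: "B \<in> interior (value_dom P)"
      and d: "((\<lambda>B'. real_of_ereal (value_fun P B')) has_real_derivative d) (at B)"
    have B': "B \<in> interior (constraint P ` admissible P)" using B by (simp add: value_dom_def)
    \<comment> \<open>Comparison with the derivative leaves at most one supergradient; that there is
      one at all comes from interiority of B.\<close>
    have "superdifferential P B \<noteq> {}" using supergradient_exists[OF B'] by (simp add: supergradients_eq)
    moreover have "p = d" if "p \<in> superdifferential P B" for p
      using supergradient_eq_derivative[OF B'] d that by (simp add: opt_value_eq supergradients_eq)
    ultimately have "superdifferential P B = {d}" by blast
    then have "\<mu> \<in> pontryagin_multipliers P B \<longleftrightarrow> - \<mu> = d" for \<mu>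
      using multipliers_agree(1)[OF B, of "- \<mu>"] by simp
    then have "pontryagin_multipliers P B = {- d}"
      by (intro set_eqI) (simp only: singleton_iff equation_minus_iff[of _ d] eq_commute)
    then show "\<exists>\<mu>. pontryagin_multipliers P B = {\<mu>} \<and> d = - \<mu>" by simp
  qed
qed

end
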